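(* Let $E$ be a second countable Stone space with at least five points. Then the natural homomorphism $\mathrm{Homeo}(E)\to\mathrm{Aut}(\mathscr{C}(E))$, $f\mapsto \big(U\sqcup V\mapsto f(U)\sqcup f(V)\big)$, is an isomorphism of topological groups, where $\mathrm{Homeo}(E)$ carries the compact–open topology and $\mathrm{Aut}(\mathscr{C}(E))$ carries the permutation topology. (Equivalently, via Stone duality, $\mathrm{Aut}(B)\cong\mathrm{Aut}(\mathscr{C}(E))$ topologically, where $B$ is the countable Boolean algebra of clopen subsets of $E$ and $\mathrm{Aut}(B)$ carries the permutation topology.)
   Context: A Stone space is a compact, Hausdorff, totally disconnected topological space. A cut of $E$ is an unordered partition of $E$ into two disjoint clopen sets $U,V$, written $U\sqcup V$. A cut is non-peripheral if each of $U$ and $V$ contains at least two points. Two cuts $U\sqcup V$ and $U'\sqcup V'$ cross if all four sets $U\cap U'$, $U\cap V'$, $V\cap U'$, $V\cap V'$ are nonempty; otherwise they are compatible. The complex of cuts $\mathscr{C}(E)$ is the simplicial graph whose vertices are the non-peripheral cuts of $E$, with an edge between two distinct cuts whenever they are compatible. The permutation topology on the automorphism group of a graph has as a neighborhood basis of the identity the pointwise stabilizers of finite sets of vertices. *)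

theory Defs
  imports "HOL-Analysis.Analysis"
begin

definition totally_disconnected_space :: "'a topology \<Rightarrow> bool" where
  "totally_disconnected_space X \<longleftrightarrow> (\<forall>S. connectedin X S \<longrightarrow> (\<exists>a. S \<subseteq> {a}))"

definition Stone_space :: "'a topology \<Rightarrow> bool" where
  "Stone_space X \<longleftrightarrow> compact_space X \<and> Hausdorff_space X \<and> totally_disconnected_space X"

definition is_cut :: "'a topology \<Rightarrow> 'a set set \<Rightarrow> bool" where
  "is_cut X c \<longleftrightarrow> (\<exists>U V. c = {U, V} \<and> openin X U \<and> closedin X U \<and> openin X V \<and> closedin X V
                    \<and> U \<inter> V = {} \<and> U \<union> V = topspace X)"

definition nonperipheral_cut :: "'a topology \<Rightarrow> 'a set set \<Rightarrow> bool" where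
  "nonperipheral_cut X c \<longleftrightarrow> is_cut X c \<and> (\<forall>A\<in>c. \<exists>x y. x \<in> A \<and> y \<in> A \<and> x \<noteq> y)"

definition cut_vertices :: "'a topology \<Rightarrow> 'a set set set" where
  "cut_vertices X = {c. nonperipheral_cut X c}"

definition cuts_cross :: "'a set set \<Rightarrow> 'a set set \<Rightarrow> bool" where
  "cuts_cross c d \<longleftrightarrow> (\<forall>A\<in>c. \<forall>B\<in>d. A \<inter> B \<noteq> {})"

definition cut_adjacent :: "'a topology \<Rightarrow> 'a set set \<Rightarrow> 'a set set \<Rightarrow> bool" where
  "cut_adjacent X c d \<longleftrightarrow> c \<in> cut_vertices X \<and> d \<in> cut_vertices X \<and> c \<noteq> d \<and> \<not> cuts_cross c d"

text \<open>Automorphisms of the complex of cuts (graph automorphisms), as maps that are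
  the identity outside the vertex set, so that equality is equality of automorphisms.\<close>
definition cut_complex_aut :: "'a topology \<Rightarrow> ('a set set \<Rightarrow> 'a set set) set" where
  "cut_complex_aut X = {\<phi>. bij_betw \<phi> (cut_vertices X) (cut_vertices X)
      \<and> (\<forall>c\<in>cut_vertices X. \<forall>d\<in>cut_vertices X. cut_adjacent X (\<phi> c) (\<phi> d) \<longleftrightarrow> cut_adjacent X c d)
      \<and> (\<forall>c. c \<notin> cut_vertices X \<longrightarrow> \<phi> c = c)}"

text \<open>Permutation topology on Aut: a set is open iff around each of its elements g it contains
  a coset g \<circ> Stab(F) of the pointwise stabilizer of a finite set F of vertices.\<close>
definition perm_topology :: "'a topology \<Rightarrow> ('a set set \<Rightarrow> 'a set set) topology" where
  "perm_topology X = topology (\<lambda>U. U \<subseteq> cut_complex_aut X \<and>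
      (\<forall>g\<in>U. \<exists>F. finite F \<and> F \<subseteq> cut_vertices X \<and>
          {\<phi>\<in>cut_complex_aut X. \<forall>v\<in>F. \<phi> v = g v} \<subseteq> U))"

definition homeo_group :: "'a topology \<Rightarrow> ('a \<Rightarrow> 'a) set" where
  "homeo_group X = {f. homeomorphic_map X X f \<and> (\<forall>x. x \<notin> topspace X \<longrightarrow> f x = x)}"

definition compact_open_homeo :: "'a topology \<Rightarrow> ('a \<Rightarrow> 'a) topology" where
  "compact_open_homeo X = subtopology
     (topology_generated_by {{f. f ` K \<subseteq> U} | K U. compactin X K \<and> openin X U})
     (homeo_group X)"

definition induced_aut :: "'a topology \<Rightarrow> ('a \<Rightarrow> 'a) \<Rightarrow> ('a set set \<Rightarrow> 'a set set)" where
  "induced_aut X f = (\<lambda>c. if c \<in> cut_vertices X then (\<lambda>U. f ` U) ` c else c)"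

end

theory Submission
  imports Defs
begin

text \<open>
  A cut adjacent to \<open>{U, E - U}\<close> has a side properly contained in \<open>U\<close> or in \<open>E - U\<close>. Two cuts on
  different sides never cross, while any two cuts on the same side are crossed by a third cut on
  that side; hence the partition of a link into its two sides is visible in the graph. With at
  least five points not both sides are empty, so a graph automorphism induces a map on the clopen
  sets \<open>U\<close> (not only on the unordered pairs \<open>{U, E - U}\<close>), and this map preserves
  inclusions and complements. It therefore preserves the intersections that still have two points,
  and compactness turns it into a homeomorphism; isolated points, where intersections degenerate
  to singletons, are located by two sides that cover \<open>E\<close> and meet in that point only.

  The same idea gives the topological statement: the image of \<open>U\<close> under a homeomorphism is
  determined by its action on the two cuts given by \<open>U\<close> and by a cut lying on one side of \<open>U\<close>.
\<close>

section \<open>Non-peripheral cuts and their sides\<close>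

definition two_points :: "'a set \<Rightarrow> bool" where
  "two_points A \<longleftrightarrow> (\<exists>x y. x \<in> A \<and> y \<in> A \<and> x \<noteq> y)"

lemma two_points_mono: "two_points A \<Longrightarrow> A \<subseteq> B \<Longrightarrow> two_points B"
  by (auto simp: two_points_def)

lemma two_points_of_card:
  assumes "2 \<le> card A"
  obtains p q where "p \<in> A" "q \<in> A" "p \<noteq> q"
proof -
  obtain T where T: "T \<subseteq> A" "card T = 2" "finite T"
    using obtain_subset_with_card_n[OF assms] by metis
  then show ?thesis
    using that by (auto simp: card_2_iff)
qed

lemma two_points_image: "inj_on f A \<Longrightarrow> two_points A \<Longrightarrow> two_points (f ` A)"
  unfolding two_points_def inj_on_def by blast

definition cut_of :: "'a topology \<Rightarrow> 'a set \<Rightarrow> 'a set set" where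
  "cut_of X W = {W, topspace X - W}"

text \<open>Every vertex of the complex comes from exactly two elements of this set,
  \<open>W\<close> and its complement. Such oriented cuts can be compared by inclusion, which
  unordered pairs cannot.\<close>

definition cut_sides :: "'a topology \<Rightarrow> 'a set set" where
  "cut_sides X = {W. openin X W \<and> closedin X W \<and> two_points W \<and> two_points (topspace X - W)}"

lemma cut_sidesD:
  assumes "W \<in> cut_sides X"
  shows "openin X W" "closedin X W" "W \<subseteq> topspace X" "two_points W" "two_points (topspace X - W)"
    "W \<noteq> {}" "topspace X - W \<noteq> {}"
  using assms by (auto simp: cut_sides_def two_points_def dest: openin_subset)

lemma cut_sides_compl: "W \<in> cut_sides X \<Longrightarrow> topspace X - W \<in> cut_sides X"
  by (auto simp: cut_sides_def double_diff openin_subset)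

lemma cut_sides_diff_diff: "W \<in> cut_sides X \<Longrightarrow> topspace X - (topspace X - W) = W"
  using cut_sidesD(3) by fastforce

lemma cut_vertices_eq: "cut_vertices X = cut_of X ` cut_sides X"
proof (intro equalityI subsetI)
  fix c assume "c \<in> cut_vertices X"
  then obtain U V where c: "c = {U, V}" "openin X U" "closedin X U" "openin X V"
      "U \<inter> V = {}" "U \<union> V = topspace X" "two_points U" "two_points V"
    by (auto simp: cut_vertices_def nonperipheral_cut_def is_cut_def two_points_def)
  have "V = topspace X - U" using c(5,6) by blast
  then have "c = cut_of X U" "U \<in> cut_sides X"
    using c by (simp_all add: cut_of_def cut_sides_def)
  then show "c \<in> cut_of X ` cut_sides X" by blast
next
  fix c assume "c \<in> cut_of X ` cut_sides X"
  then obtain W where W: "W \<in> cut_sides X" "c = cut_of X W" by blast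
  note D = cut_sidesD[OF W(1)] cut_sidesD[OF cut_sides_compl[OF W(1)]]
  have "is_cut X c"
    unfolding is_cut_def using D(1,2,3,8,9) W(2)
    by (intro exI[of _ W] exI[of _ "topspace X - W"]) (simp add: cut_of_def Un_absorb1)
  then show "c \<in> cut_vertices X"
    using D(4,5) W(2) by (simp add: cut_vertices_def nonperipheral_cut_def cut_of_def two_points_def)
qed

lemma cut_of_vertex: "W \<in> cut_sides X \<Longrightarrow> cut_of X W \<in> cut_vertices X"
  by (simp add: cut_vertices_eq)

lemma cut_of_compl: "W \<in> cut_sides X \<Longrightarrow> cut_of X (topspace X - W) = cut_of X W"
  by (auto simp: cut_of_def cut_sides_diff_diff)

lemma cut_of_eq_iff:
  assumes "U \<in> cut_sides X"
  shows "cut_of X U = cut_of X V \<longleftrightarrow> V = U \<or> V = topspace X - U"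
  using cut_sides_diff_diff[OF assms] by (auto simp: cut_of_def doubleton_eq_iff)

lemma cross_irrefl: "c \<in> cut_vertices X \<Longrightarrow> \<not> cuts_cross c c"
  by (auto simp: cut_vertices_eq cut_of_def cuts_cross_def)

lemma cross_sym: "cuts_cross c d \<Longrightarrow> cuts_cross d c"
  unfolding cuts_cross_def by (metis Int_commute)

text \<open>This makes crossing a purely graph-theoretic relation, so that automorphisms preserve
  it. The clause \<open>c \<noteq> d\<close> is there because a cut neither crosses nor is adjacent
  to itself.\<close>

lemma cross_iff_not_adjacent:
  assumes "c \<in> cut_vertices X" "d \<in> cut_vertices X"
  shows "cuts_cross c d \<longleftrightarrow> c \<noteq> d \<and> \<not> cut_adjacent X c d"
  using assms cross_irrefl[OF assms(1)] unfolding cut_adjacent_def by blast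

section \<open>Clopen separation, and sides as a subbasis\<close>

locale large_stone_space =
  fixes X :: "'a topology"
  assumes stone: "Stone_space X"
    and five: "\<exists>F. finite F \<and> card F \<ge> 5 \<and> F \<subseteq> topspace X"
begin

abbreviation E :: "'a set" where "E \<equiv> topspace X"
abbreviation P :: "'a set set" where "P \<equiv> cut_sides X"
abbreviation cut :: "'a set \<Rightarrow> 'a set set" where "cut \<equiv> cut_of X"

lemma compact: "compact_space X" and hausdorff: "Hausdorff_space X"
  using stone by (auto simp: Stone_space_def)

lemma closedin_finite: "finite S \<Longrightarrow> S \<subseteq> E \<Longrightarrow> closedin X S"
  using hausdorff closedin_Hausdorff_finite by blast

lemma closedin_Un_finite: "closedin X C \<Longrightarrow> finite S \<Longrightarrow> S \<subseteq> E \<Longrightarrow> closedin X (C \<union> S)"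
  by (simp add: closedin_Un closedin_finite)

text \<open>In a compact Hausdorff space disjoint closed sets are separated by a clopen set unless
  some connected set meets both (cut wire fence theorem); total disconnectedness leaves only
  connected sets with at most one point.\<close>

lemma clopen_separation:
  assumes "closedin X S" "closedin X T" "S \<inter> T = {}"
  obtains W where "openin X W" "closedin X W" "S \<subseteq> W" "W \<inter> T = {}"
proof -
  have "separated_between X S T"
  proof (rule cut_wire_fence_theorem[OF compact hausdorff assms(1,2)])
    fix C assume "connectedin X C"
    then obtain a where "C \<subseteq> {a}"
      using stone by (auto simp: Stone_space_def totally_disconnected_space_def)
    then show "disjnt C S \<or> disjnt C T"
      using assms(3) by (auto simp: disjnt_def)
  qed
  then obtain W where "openin X W" "closedin X W" "S \<subseteq> W" "T \<subseteq> E - W"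
    unfolding separated_between by blast
  with that show ?thesis by blast
qed

lemma compactin_closed: "closedin X S \<Longrightarrow> compactin X S"
  by (simp add: closedin_compact_space compact)

text \<open>Five points leave four after \<open>x\<close> is removed: a pair for each side of a cut,
  without recourse to \<open>x\<close>.\<close>

lemma two_two_points:
  obtains p q r s where "p \<in> E - {x}" "q \<in> E - {x}" "r \<in> E - {x}" "s \<in> E - {x}"
    "p \<noteq> q" "r \<noteq> s" "p \<noteq> r" "p \<noteq> s" "q \<noteq> r" "q \<noteq> s"
proof -
  obtain F where F: "finite F" "card F \<ge> 5" "F \<subseteq> E" using five by blast
  have "card (F - {x}) \<ge> 4" using F by (auto simp: card_Diff_singleton_if)
  then obtain p q where pq: "p \<in> F - {x}" "q \<in> F - {x}" "p \<noteq> q"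
    using two_points_of_card[of "F - {x}"] by auto
  have "card (F - {x} - {p, q}) = card (F - {x}) - 2"
    using F pq by (subst card_Diff_subset) auto
  with \<open>card (F - {x}) \<ge> 4\<close> have "2 \<le> card (F - {x} - {p, q})" by linarith
  then obtain r s where rs: "r \<in> F - {x} - {p, q}" "s \<in> F - {x} - {p, q}" "r \<noteq> s"
    using two_points_of_card by metis
  show ?thesis by (rule that[of p q r s]) (use pq rs F in auto)
qed

text \<open>Pigeonhole: \<open>U\<close> or its complement contains at least three of five points,
  and there two of them can be separated from the third.\<close>

lemma proper_subside_or:
  assumes "U \<in> P"
  shows "(\<exists>D\<in>P. D \<subset> U) \<or> (\<exists>D\<in>P. D \<subset> E - U)"
proof -
  have *: "\<exists>D\<in>P. D \<subset> V" if V: "V \<in> P" and card: "card (F \<inter> V) \<ge> 3" and "finite F" for F V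
  proof -
    obtain T where T: "T \<subseteq> F \<inter> V" "card T = 3" "finite T"
      using obtain_subset_with_card_n[OF card] by metis
    then obtain x y z where xyz: "T = {x, y, z}" "x \<noteq> y" "y \<noteq> z" "x \<noteq> z"
      by (auto simp: card_3_iff)
    have VE: "V \<subseteq> E" using V by (rule cut_sidesD)
    have xyz': "x \<in> E" "y \<in> E" "z \<in> E" using xyz T VE by auto
    \<comment> \<open>Containing \<open>x\<close> and \<open>y\<close> gives \<open>D\<close> its
      two points, missing \<open>z\<close> makes the inclusion in \<open>V\<close> proper, and
      missing \<open>E - V\<close> keeps \<open>D\<close> inside \<open>V\<close>.\<close>
    have "closedin X {x, y}" using xyz' closedin_finite by simp
    moreover have "closedin X (insert z (E - V))"
      using closedin_Un[OF closedin_finite[of "{z}"] cut_sidesD(2)[OF cut_sides_compl[OF V]]] xyz' by simp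
    ultimately obtain D where D: "openin X D" "closedin X D" "{x, y} \<subseteq> D" "D \<inter> insert z (E - V) = {}"
      using clopen_separation[of "{x, y}" "insert z (E - V)"] xyz T by auto
    then have "D \<subset> V" using xyz T openin_subset by fastforce
    moreover have "two_points D" using D(3) xyz(2) by (auto simp: two_points_def)
    moreover have "two_points (E - D)"
      using cut_sidesD(5)[OF V] by (rule two_points_mono) (use \<open>D \<subset> V\<close> in auto)
    ultimately show ?thesis using D by (auto simp: cut_sides_def)
  qed
  obtain F where F: "finite F" "card F \<ge> 5" "F \<subseteq> E" using five by blast
  have "card F = card (F \<inter> U) + card (F \<inter> (E - U))"
    using F by (subst card_Un_disjoint[symmetric]) (auto intro: arg_cong[of _ _ card])
  then have "card (F \<inter> U) \<ge> 3 \<or> card (F \<inter> (E - U)) \<ge> 3" using F(2) by linarith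
  then show ?thesis
    using *[OF assms] *[OF cut_sides_compl[OF assms]] F(1) by blast
qed

text \<open>A singleton is never a side, so an isolated point has to be reached as an intersection:
  a clopen set and its complement, each with two further points, are both enlarged by
  \<open>x\<close>.\<close>

lemma isolated_point_partition:
  assumes "openin X {x}"
  obtains U V where "U \<in> P" "V \<in> P" "U \<inter> V = {x}" "U \<union> V = E" "two_points (U - V)" "two_points (V - U)"
proof -
  obtain p q r s where pt: "p \<in> E - {x}" "q \<in> E - {x}" "r \<in> E - {x}" "s \<in> E - {x}"
    "p \<noteq> q" "r \<noteq> s" "p \<noteq> r" "p \<noteq> s" "q \<noteq> r" "q \<noteq> s" using two_two_points[of x] by blast
  have x: "x \<in> E" using assms openin_subset by blast
  obtain W where W: "openin X W" "closedin X W" "{p, q} \<subseteq> W" "W \<inter> {r, s} = {}"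
    using clopen_separation[of "{p, q}" "{r, s}"] pt closedin_finite by auto
  have cx: "closedin X {x}" using x closedin_finite by simp
  define U where "U = W \<union> {x}"
  define V where "V = (E - W) \<union> {x}"
  have WE: "W \<subseteq> E" using W(1) by (rule openin_subset)
  have oU: "openin X U" "closedin X U" and oV: "openin X V" "closedin X V"
    unfolding U_def V_def using W assms cx by (intro openin_Un closedin_Un openin_diff closedin_diff; simp)+
  have tp: "two_points (U - V)" "two_points (V - U)"
    using pt W unfolding two_points_def U_def V_def by blast+
  show ?thesis
  proof (rule that)
    show "U \<inter> V = {x}" "U \<union> V = E" using x WE by (auto simp: U_def V_def)
    have "U \<subseteq> E" "V \<subseteq> E" using oU oV openin_subset by auto
    then show "U \<in> P" "V \<in> P" using oU oV tp
      by (auto simp: cut_sides_def intro: two_points_mono)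
  qed (use tp in auto)
qed

text \<open>A non-isolated point has arbitrarily small sides around it, so \<open>U = V\<close> is
  possible. At an isolated point two different sides are required, meeting in that point
  alone.\<close>

lemma subbasis:
  assumes "openin X O'" "x \<in> O'"
  obtains U V where "U \<in> P" "V \<in> P" "x \<in> U" "x \<in> V" "U \<inter> V \<subseteq> O'"
proof (cases "openin X {x}")
  case True
  then show ?thesis
    using that assms by (metis isolated_point_partition IntE empty_subsetI insert_subset singletonI)
next
  case False
  obtain p q r s where pt: "p \<in> E - {x}" "q \<in> E - {x}" "p \<noteq> q" using two_two_points[of x] by blast
  have "x \<in> E" using assms openin_subset by blast
  then have "closedin X {x}" by (simp add: closedin_finite)
  \<comment> \<open>Besides staying inside \<open>O'\<close>, the set \<open>W\<close> has to miss
    \<open>p\<close> and \<open>q\<close>, so that its complement has two points; \<open>W\<close>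
    has a second point since \<open>{x}\<close> is not open.\<close>
  moreover have "closedin X ((E - O') \<union> {p, q})"
    using assms pt by (intro closedin_Un_finite closedin_diff) auto
  ultimately obtain W where W: "openin X W" "closedin X W" "x \<in> W" "W \<inter> ((E - O') \<union> {p, q}) = {}"
    using clopen_separation[of "{x}" "(E - O') \<union> {p, q}"] pt assms(2) by auto
  have "W \<noteq> {x}" using W False by metis
  then have "two_points W" using W(3) by (auto simp: two_points_def)
  moreover have "two_points (E - W)" using pt W(4) by (auto simp: two_points_def)
  ultimately have "W \<in> P" using W by (auto simp: cut_sides_def)
  moreover have "W \<subseteq> O'" using W(1,4) openin_subset by blast
  ultimately show ?thesis using that[of W W] W by auto
qed

lemma separates_points:
  assumes "x \<in> E" "y \<in> E" "x \<noteq> y"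
  obtains W where "W \<in> P" "x \<in> W" "y \<notin> W"
proof -
  have "openin X (E - {y})" using assms closedin_finite by (auto intro!: openin_diff)
  then obtain U V where "U \<in> P" "V \<in> P" "x \<in> U" "x \<in> V" "U \<inter> V \<subseteq> E - {y}"
    using subbasis[of "E - {y}" x] assms by blast
  with that show ?thesis by blast
qed

subsection \<open>Sides of links in the complex of cuts\<close>

definition on_side :: "'a set \<Rightarrow> 'a set set \<Rightarrow> bool" where
  "on_side U d \<longleftrightarrow> (\<exists>D\<in>P. d = cut D \<and> D \<subset> U)"

text \<open>Compatibility means that one of the four corners is empty, which puts a side of
  \<open>d\<close> inside \<open>U\<close> or inside \<open>E - U\<close>; distinctness of the cuts
  makes the inclusion proper.\<close>

lemma adjacent_iff_on_side:
  assumes U: "U \<in> P"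
  shows "cut_adjacent X (cut U) d \<longleftrightarrow> on_side U d \<or> on_side (E - U) d"
proof
  assume adj: "cut_adjacent X (cut U) d"
  then obtain D where D: "D \<in> P" "d = cut D"
    by (auto simp: cut_adjacent_def cut_vertices_eq)
  have ne: "D \<noteq> U" "D \<noteq> E - U" using adj D(2) cut_of_eq_iff[OF U] by (auto simp: cut_adjacent_def)
  have ne': "E - D \<noteq> U" "E - D \<noteq> E - U" using ne cut_sides_diff_diff[OF D(1)] cut_sides_diff_diff[OF U] by auto
  have sub: "D \<subseteq> E" "U \<subseteq> E" using D U cut_sidesD(3) by auto
  have "U \<inter> D = {} \<or> U \<inter> (E - D) = {} \<or> (E - U) \<inter> D = {} \<or> (E - U) \<inter> (E - D) = {}"
    using adj D(2) by (auto simp: cut_adjacent_def cuts_cross_def cut_of_def)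
  then have "D \<subseteq> E - U \<or> E - D \<subseteq> E - U \<or> D \<subseteq> U \<or> E - D \<subseteq> U"
    using sub by fast
  then have "D \<subset> E - U \<or> E - D \<subset> E - U \<or> D \<subset> U \<or> E - D \<subset> U"
    by (simp only: psubset_eq ne ne' not_False_eq_True simp_thms)
  moreover have "E - D \<in> P" "d = cut (E - D)"
    using cut_sides_compl[OF D(1)] cut_of_compl[OF D(1)] D(2) by simp_all
  ultimately show "on_side U d \<or> on_side (E - U) d"
    using D unfolding on_side_def by blast
next
  have *: "cut_adjacent X (cut V) d" if V: "V \<in> P" and d: "on_side V d" for V
  proof -
    obtain D where D: "D \<in> P" "d = cut D" "D \<subset> V" using d by (auto simp: on_side_def)
    have "cut V \<noteq> d"
      using D cut_sidesD[OF V] cut_sidesD[OF D(1)] by (auto simp: cut_of_eq_iff[OF V])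
    moreover have "\<not> cuts_cross (cut V) d"
      using D by (auto simp: cuts_cross_def cut_of_def)
    ultimately show ?thesis
      using D V by (auto simp: cut_adjacent_def cut_of_vertex)
  qed
  assume "on_side U d \<or> on_side (E - U) d"
  then show "cut_adjacent X (cut U) d"
    using *[OF U] *[OF cut_sides_compl[OF U], unfolded cut_of_compl[OF U]] by blast
qed

text \<open>Disjoint \<open>D\<close> and \<open>D'\<close> have an empty corner, and properness of
  the inclusions prevents them from being complementary.\<close>

lemma opposite_sides:
  assumes "on_side U d" "on_side (E - U) d'"
  shows "d \<noteq> d'" "\<not> cuts_cross d d'"
proof -
  obtain D D' where D: "D \<in> P" "d = cut D" "D \<subset> U" "D' \<in> P" "d' = cut D'" "D' \<subset> E - U"
    using assms unfolding on_side_def by (elim bexE conjE) (rule that)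
  have "D' \<noteq> D" "D' \<noteq> E - D" using D(3,6) cut_sidesD[OF D(1)] cut_sidesD[OF D(4)] by blast+
  then show "d \<noteq> d'" using D(2,5) cut_of_eq_iff[OF D(1)] by auto
  show "\<not> cuts_cross d d'" using D by (auto simp: cuts_cross_def cut_of_def)
qed

text \<open>A set \<open>W\<close> inside \<open>U\<close> crosses \<open>D\<close> once it contains
  a point in \<open>D\<close> and a point outside \<open>D\<close> and misses a point of
  \<open>D\<close>; the fourth corner is met outside \<open>U\<close>. So \<open>W\<close> should
  contain \<open>a\<close> and \<open>b\<close>, separated by both \<open>D\<close> and
  \<open>D'\<close>, and miss \<open>a'\<close> and \<open>b'\<close>.\<close>

lemma common_crosser:
  assumes U: "U \<in> P" and d: "on_side U d" and d': "on_side U d'"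
  shows "\<exists>e. on_side U e \<and> cuts_cross d e \<and> cuts_cross e d'"
proof -
  obtain D D' where D: "D \<in> P" "d = cut D" "D \<subset> U" and D': "D' \<in> P" "d' = cut D'" "D' \<subset> U"
    using d d' unfolding on_side_def by (elim bexE conjE) (rule that)
  have UE: "U \<subseteq> E" using U by (rule cut_sidesD)
  have "\<exists>a b a' b'. a \<in> U \<and> b \<in> U \<and> a \<noteq> a' \<and> a \<noteq> b' \<and> b \<noteq> a' \<and> b \<noteq> b' \<and> a' \<in> D \<and> b' \<in> D' \<and>
     (a \<in> D \<or> b \<in> D) \<and> (a \<notin> D \<or> b \<notin> D) \<and> (a \<in> D' \<or> b \<in> D') \<and> (a \<notin> D' \<or> b \<notin> D')"
  proof -
    \<comment> \<open>If one set contains the other, the smaller one supplies \<open>a\<close> and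
      \<open>a'\<close>, where \<open>a'\<close> can also serve as \<open>b'\<close>, and
      \<open>b\<close> is taken outside the larger one. Otherwise \<open>a\<close> and
      \<open>b\<close> come from the two differences.\<close>
    have nest: "\<exists>a b a'. a \<in> A \<and> a' \<in> A \<and> a \<noteq> a' \<and> b \<in> U - B" if "A \<in> P" "B \<subset> U" for A B
      using that cut_sidesD(4)[OF that(1)] by (auto simp: two_points_def)
    consider "D \<subseteq> D'" | "D' \<subseteq> D" | "\<not> D \<subseteq> D'" "\<not> D' \<subseteq> D" by blast
    then show ?thesis
    proof cases
      case 1
      obtain a b a' where "a \<in> D" "a' \<in> D" "a \<noteq> a'" "b \<in> U - D'" using nest[OF D(1) D'(3)] by blast
      then show ?thesis using 1 D(3) by (intro exI[of _ a] exI[of _ b] exI[of _ a']) auto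
    next
      case 2
      obtain a b a' where "a \<in> D'" "a' \<in> D'" "a \<noteq> a'" "b \<in> U - D" using nest[OF D'(1) D(3)] by blast
      then show ?thesis using 2 D'(3) by (intro exI[of _ a] exI[of _ b] exI[of _ a']) auto
    next
      case 3
      then obtain a b where ab: "a \<in> D" "a \<notin> D'" "b \<in> D'" "b \<notin> D" by blast
      obtain a' where "a' \<in> D" "a' \<noteq> a" using cut_sidesD(4)[OF D(1)] by (auto simp: two_points_def)
      moreover obtain b' where "b' \<in> D'" "b' \<noteq> b" using cut_sidesD(4)[OF D'(1)] by (auto simp: two_points_def)
      ultimately show ?thesis using ab D(3) D'(3)
        by (intro exI[of _ a] exI[of _ b] exI[of _ a'] exI[of _ b']) auto
    qed
  qed
  then obtain a b a' b' where ab: "a \<in> U" "b \<in> U" "a \<noteq> a'" "a \<noteq> b'" "b \<noteq> a'" "b \<noteq> b'" "a' \<in> D" "b' \<in> D'"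
     "a \<in> D \<or> b \<in> D" "a \<notin> D \<or> b \<notin> D" "a \<in> D' \<or> b \<in> D'" "a \<notin> D' \<or> b \<notin> D'"
    by blast
  have "a \<noteq> b" using ab by blast
  have "closedin X {a, b}" using ab(1,2) UE by (auto intro!: closedin_finite)
  moreover have "closedin X ((E - U) \<union> {a', b'})"
    using ab(7,8) UE D(3) D'(3) cut_sidesD(2)[OF cut_sides_compl[OF U]]
    by (intro closedin_Un_finite) auto
  ultimately obtain W where W: "openin X W" "closedin X W" "{a, b} \<subseteq> W" "W \<inter> ((E - U) \<union> {a', b'}) = {}"
    using clopen_separation[of "{a, b}" "(E - U) \<union> {a', b'}"] ab by auto
  have WU: "W \<subset> U" using W(1,4) openin_subset[OF W(1)] ab D by blast
  have "two_points W" using W(3) \<open>a \<noteq> b\<close> by (auto simp: two_points_def)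
  moreover have "two_points (E - W)"
    using cut_sidesD(5)[OF U] by (rule two_points_mono) (use WU in auto)
  ultimately have WP: "W \<in> P" using W by (auto simp: cut_sides_def)
  obtain z where z: "z \<in> E" "z \<notin> U" using cut_sidesD(7)[OF U] by blast
  have cr: "A \<inter> W \<noteq> {} \<and> A \<inter> (E - W) \<noteq> {} \<and> (E - A) \<inter> W \<noteq> {} \<and> (E - A) \<inter> (E - W) \<noteq> {}"
    if A: "A \<subset> U" and "a \<in> A \<or> b \<in> A" "a \<notin> A \<or> b \<notin> A" "c \<in> A" "c \<notin> W" for A c
  proof (intro conjI)
    show "A \<inter> W \<noteq> {}" using that(2) W(3) by auto
    show "A \<inter> (E - W) \<noteq> {}" using that(1,4,5) UE by auto
    show "(E - A) \<inter> W \<noteq> {}" using that(3) W(3) UE ab(1,2) by auto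
    show "(E - A) \<inter> (E - W) \<noteq> {}" using z that(1) WU by auto
  qed
  have a': "a' \<notin> W" and b': "b' \<notin> W" using W(4) by auto
  have "cuts_cross d (cut W)"
    unfolding cuts_cross_def cut_of_def D(2) using cr[OF D(3) ab(9,10,7) a'] by simp
  moreover have "cuts_cross (cut W) d'"
    unfolding cuts_cross_def cut_of_def D'(2) using cr[OF D'(3) ab(11,12,8) b'] by (simp add: Int_commute)
  ultimately show ?thesis
    using WP WU unfolding on_side_def by blast
qed

text \<open>Only adjacency and crossing occur here, so graph automorphisms respect it: it asks for a
  common crosser within the link of \<open>c\<close>.\<close>

definition same_side :: "'a set set \<Rightarrow> 'a set set \<Rightarrow> 'a set set \<Rightarrow> bool" where
  "same_side c d d' \<longleftrightarrow> (\<exists>e. cut_adjacent X c e \<and> cuts_cross d e \<and> cuts_cross e d')"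

text \<open>On one side a common crosser exists. If the sides differ, any \<open>e\<close> in the
  link lies on one of them and is compatible with the cut on the other.\<close>

lemma same_side_iff:
  assumes U: "U \<in> P" and d: "cut_adjacent X (cut U) d" "cut_adjacent X (cut U) d'"
  shows "same_side (cut U) d d' \<longleftrightarrow> (on_side U d \<longleftrightarrow> on_side U d')"
proof -
  note adj = adjacent_iff_on_side[OF U]
  note CU = cut_sides_compl[OF U]
  have os: "d \<noteq> d' \<and> \<not> cuts_cross d d' \<and> \<not> cuts_cross d' d" if "on_side U d" "on_side (E - U) d'" for d d'
    using opposite_sides[OF that] cross_sym by blast
  have "same_side (cut U) d d'" if "on_side U d" "on_side U d'"
    using common_crosser[OF U that] unfolding same_side_def adj by blast
  moreover have "same_side (cut U) d d'" if "on_side (E - U) d" "on_side (E - U) d'"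
    using common_crosser[OF CU that] unfolding same_side_def adj by blast
  moreover have "\<not> same_side (cut U) d d'" if "on_side U d" "on_side (E - U) d'" for d d'
    using os that unfolding same_side_def adj by blast
  moreover have "\<not> same_side (cut U) d d'" if "on_side (E - U) d" "on_side U d'" for d d'
    using os that unfolding same_side_def adj by blast
  ultimately show ?thesis using d os unfolding adj by blast
qed

text \<open>This is an automorphism of the clopen algebra as far as the complex sees it: clopen sets
  with fewer than two points inside or outside are absent.\<close>

definition side_aut :: "('a set \<Rightarrow> 'a set) \<Rightarrow> bool" where
  "side_aut \<psi> \<longleftrightarrow> bij_betw \<psi> P P \<and> (\<forall>U\<in>P. \<psi> (E - U) = E - \<psi> U) \<and>
     (\<forall>U\<in>P. \<forall>V\<in>P. U \<subseteq> V \<longleftrightarrow> \<psi> U \<subseteq> \<psi> V)"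

text \<open>A cut does not tell its sides apart, so the first condition alone would also allow
  \<open>E - U \<subset> V\<close>; the second one settles the orientation.\<close>

lemma psubset_iff_on_side:
  assumes U: "U \<in> P" and V: "V \<in> P"
  shows "U \<subset> V \<longleftrightarrow> on_side V (cut U) \<and> on_side (E - U) (cut V)"
proof
  assume UV: "U \<subset> V"
  then have "E - V \<subset> E - U" using cut_sidesD(3)[OF U] cut_sidesD(3)[OF V] by blast
  then show "on_side V (cut U) \<and> on_side (E - U) (cut V)"
    unfolding on_side_def using U UV cut_sides_compl[OF V] cut_of_compl[OF V] by metis
next
  assume "on_side V (cut U) \<and> on_side (E - U) (cut V)"
  then obtain D D' where D: "cut U = cut D" "D \<subset> V" and D': "cut V = cut D'" "D' \<subset> E - U"
    unfolding on_side_def by (elim bexE conjE) (rule that)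
  have "D = U \<or> D = E - U" using D(1) cut_of_eq_iff[OF U] by simp
  moreover have "D' = V \<or> D' = E - V" using D'(1) cut_of_eq_iff[OF V] by simp
  ultimately show "U \<subset> V"
    using D(2) D'(2) cut_sidesD(3)[OF U] cut_sidesD(3)[OF V] by blast
qed

section \<open>Orienting the action of a graph automorphism\<close>

context
  fixes \<phi> assumes \<phi>: "\<phi> \<in> cut_complex_aut X"
begin

lemma aut_vertex: "c \<in> cut_vertices X \<Longrightarrow> \<phi> c \<in> cut_vertices X"
  using \<phi> by (auto simp: cut_complex_aut_def bij_betw_def)

lemma aut_inj: "c \<in> cut_vertices X \<Longrightarrow> d \<in> cut_vertices X \<Longrightarrow> \<phi> c = \<phi> d \<longleftrightarrow> c = d"
  using \<phi> by (auto simp: cut_complex_aut_def bij_betw_def inj_on_def)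

lemma aut_surj:
  assumes "c \<in> cut_vertices X"
  shows "\<exists>d\<in>cut_vertices X. \<phi> d = c"
proof -
  have "c \<in> \<phi> ` cut_vertices X" using \<phi> assms by (simp add: cut_complex_aut_def bij_betw_def)
  then show ?thesis by blast
qed

lemma aut_adjacent:
  "c \<in> cut_vertices X \<Longrightarrow> d \<in> cut_vertices X \<Longrightarrow> cut_adjacent X (\<phi> c) (\<phi> d) \<longleftrightarrow> cut_adjacent X c d"
  using \<phi> by (simp add: cut_complex_aut_def)

lemma aut_cross:
  "c \<in> cut_vertices X \<Longrightarrow> d \<in> cut_vertices X \<Longrightarrow> cuts_cross (\<phi> c) (\<phi> d) \<longleftrightarrow> cuts_cross c d"
  by (simp add: cross_iff_not_adjacent[where X = X] aut_vertex aut_inj aut_adjacent)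

lemma aut_same_side:
  assumes "c \<in> cut_vertices X" "d \<in> cut_vertices X" "d' \<in> cut_vertices X"
  shows "same_side (\<phi> c) (\<phi> d) (\<phi> d') \<longleftrightarrow> same_side c d d'"
proof
  assume "same_side c d d'"
  then obtain e where e: "cut_adjacent X c e" "cuts_cross d e" "cuts_cross e d'"
    by (auto simp: same_side_def)
  then have "e \<in> cut_vertices X" by (simp add: cut_adjacent_def)
  with e assms show "same_side (\<phi> c) (\<phi> d) (\<phi> d')"
    unfolding same_side_def by (intro exI[of _ "\<phi> e"]) (simp add: aut_adjacent aut_cross)
next
  assume "same_side (\<phi> c) (\<phi> d) (\<phi> d')"
  then obtain e where e: "cut_adjacent X (\<phi> c) e" "cuts_cross (\<phi> d) e" "cuts_cross e (\<phi> d')"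
    by (auto simp: same_side_def)
  then obtain e' where "e' \<in> cut_vertices X" "e = \<phi> e'" using aut_surj[of e] by (auto simp: cut_adjacent_def)
  with e assms show "same_side c d d'"
    unfolding same_side_def by (intro exI[of _ e']) (simp add: aut_adjacent aut_cross)
qed

text \<open>\<phi> yields only an unordered pair \<open>cut V\<close>; matching the sides of the
  links selects which of its two members is the image of \<open>U\<close>.\<close>

definition transports :: "'a set \<Rightarrow> 'a set \<Rightarrow> bool" where
  "transports U V \<longleftrightarrow> U \<in> P \<and> V \<in> P \<and> \<phi> (cut U) = cut V \<and>
     (\<forall>d. cut_adjacent X (cut U) d \<longrightarrow> (on_side U d \<longleftrightarrow> on_side V (\<phi> d)))"

lemma on_side_compl_iff:
  assumes "U \<in> P" "cut_adjacent X (cut U) d"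
  shows "on_side (E - U) d \<longleftrightarrow> \<not> on_side U d"
  using adjacent_iff_on_side[OF assms(1), of d] opposite_sides[of U d d] assms(2) by blast

lemma adjacent_aut:
  assumes "U \<in> P" "\<phi> (cut U) = cut V" "cut_adjacent X (cut U) d"
  shows "cut_adjacent X (cut V) (\<phi> d)"
  using aut_adjacent[of "cut U" d] assms by (auto simp: cut_adjacent_def)

lemma transports_compl:
  assumes "transports U V"
  shows "transports (E - U) (E - V)"
proof -
  have U: "U \<in> P" and V: "V \<in> P" and c: "\<phi> (cut U) = cut V"
    and s: "\<And>d. cut_adjacent X (cut U) d \<Longrightarrow> on_side U d \<longleftrightarrow> on_side V (\<phi> d)"
    using assms by (auto simp: transports_def)
  have "on_side (E - U) d \<longleftrightarrow> on_side (E - V) (\<phi> d)" if "cut_adjacent X (cut U) d" for d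
    using on_side_compl_iff[OF U that] on_side_compl_iff[OF V adjacent_aut[OF U c that]] s[OF that] by simp
  then show ?thesis
    unfolding transports_def cut_of_compl[OF U] cut_of_compl[OF V]
    using c cut_sides_compl[OF U] cut_sides_compl[OF V] by blast
qed

lemma adjacent_exists:
  assumes "U \<in> P"
  obtains d where "cut_adjacent X (cut U) d"
  using proper_subside_or[OF assms] adjacent_iff_on_side[OF assms] unfolding on_side_def by blast

text \<open>A single link vertex \<open>d\<close> decides between \<open>V\<^sub>0\<close> and its
  complement. As \<phi> preserves \<open>same_side\<close>, which tells the two sides of a link
  apart, the choice fits all other link vertices.\<close>

lemma transports_exists:
  assumes U: "U \<in> P"
  shows "\<exists>V. transports U V"
proof -
  obtain d where d: "cut_adjacent X (cut U) d" using adjacent_exists[OF U] .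
  obtain V\<^sub>0 where V0: "V\<^sub>0 \<in> P" "\<phi> (cut U) = cut V\<^sub>0"
    using aut_vertex[OF cut_of_vertex[OF U]] by (auto simp: cut_vertices_eq)
  have "on_side (E - V\<^sub>0) (\<phi> d) \<longleftrightarrow> \<not> on_side V\<^sub>0 (\<phi> d)"
    using on_side_compl_iff[OF V0(1) adjacent_aut[OF U V0(2) d]] .
  then obtain V where V: "V \<in> P" "\<phi> (cut U) = cut V" "on_side U d \<longleftrightarrow> on_side V (\<phi> d)"
    using V0 cut_sides_compl[OF V0(1)] cut_of_compl[OF V0(1)] by metis
  have "on_side U d' \<longleftrightarrow> on_side V (\<phi> d')" if d': "cut_adjacent X (cut U) d'" for d'
  proof -
    have "same_side (cut V) (\<phi> d) (\<phi> d') \<longleftrightarrow> same_side (cut U) d d'"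
      using aut_same_side[of "cut U" d d'] V(2) d d' by (simp add: cut_adjacent_def)
    then show ?thesis
      using same_side_iff[OF U d d'] V(3)
        same_side_iff[OF V(1) adjacent_aut[OF U V(2) d] adjacent_aut[OF U V(2) d']] by blast
  qed
  with U V show ?thesis unfolding transports_def by blast
qed

text \<open>Equal images leave \<open>U' = E - U\<close> as the only alternative, and then a link
  vertex would be on both sides or on neither.\<close>

lemma transports_inj:
  assumes "transports U V" "transports U' V"
  shows "U = U'"
proof (rule ccontr)
  assume ne: "U \<noteq> U'"
  have P: "U \<in> P" "U' \<in> P" and "\<phi> (cut U) = \<phi> (cut U')" using assms by (auto simp: transports_def)
  then have "cut U = cut U'" using aut_inj[OF cut_of_vertex cut_of_vertex] by blast
  then have U': "U' = E - U" using ne cut_of_eq_iff[OF P(1)] by blast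
  obtain d where d: "cut_adjacent X (cut U) d" using adjacent_exists[OF P(1)] .
  have "on_side U d \<longleftrightarrow> on_side U' d"
    using assms d \<open>cut U = cut U'\<close> by (simp add: transports_def)
  then show False using on_side_compl_iff[OF P(1) d] U' by simp
qed

lemma transports_unique:
  assumes "transports U V" "transports U V'"
  shows "V = V'"
proof (rule ccontr)
  assume ne: "V \<noteq> V'"
  have P: "U \<in> P" "V \<in> P" "V' \<in> P" and "cut V = cut V'" using assms by (auto simp: transports_def)
  then have V': "V' = E - V" using ne cut_of_eq_iff[OF P(2)] by blast
  then have "U = E - U" using transports_inj[OF assms(2)] transports_compl[OF assms(1)] by blast
  then show False using cut_sidesD(3,6)[OF P(1)] by blast
qed

text \<open>Outside the link both statements are false.\<close>

lemma transports_on_side: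
  assumes "transports U V" "W \<in> P"
  shows "on_side U (cut W) \<longleftrightarrow> on_side V (\<phi> (cut W))"
proof (cases "cut_adjacent X (cut U) (cut W)")
  case True
  then show ?thesis using assms by (simp add: transports_def)
next
  case False
  have P: "U \<in> P" "V \<in> P" and "\<phi> (cut U) = cut V" using assms by (auto simp: transports_def)
  then have "\<not> cut_adjacent X (cut V) (\<phi> (cut W))"
    using False aut_adjacent[OF cut_of_vertex cut_of_vertex] assms(2) by metis
  then show ?thesis
    using False adjacent_iff_on_side[OF P(1)] adjacent_iff_on_side[OF P(2)] by blast
qed

text \<open>The criterion \<open>psubset_iff_on_side\<close> refers to \<open>U'\<close> and
  \<open>E - U\<close> only, and both are transported, the latter by
  \<open>transports_compl\<close>.\<close>

lemma transports_psubset: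
  assumes "transports U V" "transports U' V'"
  shows "U \<subset> U' \<longleftrightarrow> V \<subset> V'"
proof -
  have P: "U \<in> P" "V \<in> P" "U' \<in> P" "V' \<in> P" and c: "\<phi> (cut U) = cut V" "\<phi> (cut U') = cut V'"
    using assms by (auto simp: transports_def)
  show ?thesis
    unfolding psubset_iff_on_side[OF P(1,3)] psubset_iff_on_side[OF P(2,4)]
    using transports_on_side[OF assms(2) P(1)] transports_on_side[OF transports_compl[OF assms(1)] P(3)] c
    by simp
qed

lemma side_aut_of_aut: "\<exists>\<psi>. side_aut \<psi> \<and> (\<forall>U\<in>P. \<phi> (cut U) = cut (\<psi> U))"
proof -
  obtain \<psi> where \<psi>: "\<And>U. U \<in> P \<Longrightarrow> transports U (\<psi> U)"
    using transports_exists by metis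
  have eq: "\<psi> U = V" if "transports U V" for U V
    using that \<psi> transports_unique by (metis transports_def)
  have into: "\<psi> U \<in> P" and c: "\<phi> (cut U) = cut (\<psi> U)" if "U \<in> P" for U
    using \<psi>[OF that] by (auto simp: transports_def)
  have inj: "inj_on \<psi> P" using \<psi> transports_inj by (metis inj_onI)
  have "V \<in> \<psi> ` P" if V: "V \<in> P" for V
  proof -
    obtain U where U: "U \<in> P" "\<phi> (cut U) = cut V"
      using aut_surj[OF cut_of_vertex[OF V]] by (auto simp: cut_vertices_eq)
    \<comment> \<open>Surjectivity on cuts yields \<open>V\<close> up to complement; since \<psi>
      commutes with complements, passing to \<open>E - U\<close> corrects the orientation.\<close>
    then have "V = \<psi> U \<or> V = E - \<psi> U" using c[OF U(1)] cut_of_eq_iff[OF into[OF U(1)]] by simp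
    moreover have "\<psi> (E - U) = E - \<psi> U" using eq[OF transports_compl[OF \<psi>[OF U(1)]]] .
    ultimately show ?thesis using U(1) cut_sides_compl[OF U(1)] by (metis imageI)
  qed
  with inj into have "bij_betw \<psi> P P" by (auto simp: bij_betw_def)
  moreover have "\<psi> (E - U) = E - \<psi> U" if "U \<in> P" for U
    using eq[OF transports_compl[OF \<psi>[OF that]]] .
  moreover have "U \<subseteq> V \<longleftrightarrow> \<psi> U \<subseteq> \<psi> V" if "U \<in> P" "V \<in> P" for U V
    using transports_psubset[OF \<psi> \<psi>, OF that] inj that unfolding subset_iff_psubset_eq inj_on_def by blast
  ultimately have "side_aut \<psi>" unfolding side_aut_def by blast
  with c show ?thesis by (intro exI[of _ \<psi>]) simp
qed

end

subsection \<open>From maps of clopen sets to homeomorphisms\<close>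

lemma cut_sides_Int:
  assumes "U \<in> P" "V \<in> P" "two_points (U \<inter> V)"
  shows "U \<inter> V \<in> P"
proof -
  have "two_points (E - U \<inter> V)"
    using cut_sidesD(5)[OF assms(1)] by (rule two_points_mono) auto
  with assms show ?thesis by (simp add: cut_sides_def openin_Int closedin_Int)
qed

lemma side_aut_inv_into:
  assumes "side_aut \<psi>"
  shows "side_aut (inv_into P \<psi>)"
proof -
  let ?i = "inv_into P \<psi>"
  have bij: "bij_betw \<psi> P P" and compl: "\<And>U. U \<in> P \<Longrightarrow> \<psi> (E - U) = E - \<psi> U"
    and ord: "\<And>U V. U \<in> P \<Longrightarrow> V \<in> P \<Longrightarrow> U \<subseteq> V \<longleftrightarrow> \<psi> U \<subseteq> \<psi> V"
    using assms by (auto simp: side_aut_def)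
  have ib: "bij_betw ?i P P" using bij by (rule bij_betw_inv_into)
  have P: "?i U \<in> P" "\<psi> (?i U) = U" if "U \<in> P" for U
    using that ib bij_betw_inv_into_right[OF bij] by (auto simp: bij_betw_def)
  have "?i (E - U) = E - ?i U" if "U \<in> P" for U
    using compl[OF P(1)[OF that]] P(2)[OF that] bij_betw_inv_into_left[OF bij cut_sides_compl[OF P(1)[OF that]]]
    by simp
  moreover have "U \<subseteq> V \<longleftrightarrow> ?i U \<subseteq> ?i V" if "U \<in> P" "V \<in> P" for U V
    using ord[OF P(1) P(1), OF that] P(2) that by simp
  ultimately show ?thesis using ib unfolding side_aut_def by blast
qed

lemma continuous_map_cut_sidesI:
  assumes "\<And>x. x \<in> E \<Longrightarrow> g x \<in> E" "\<And>V. V \<in> P \<Longrightarrow> openin X {x \<in> E. g x \<in> V}"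
  shows "continuous_map X X g"
  unfolding continuous_map_def
proof (intro conjI allI impI)
  show "g \<in> E \<rightarrow> E" using assms(1) by blast
  fix S assume S: "openin X S"
  show "openin X {x \<in> E. g x \<in> S}"
  proof (subst openin_subopen, intro ballI)
    fix x assume "x \<in> {x \<in> E. g x \<in> S}"
    then have x: "x \<in> E" "g x \<in> S" by auto
    obtain U V where UV: "U \<in> P" "V \<in> P" "g x \<in> U" "g x \<in> V" "U \<inter> V \<subseteq> S"
      using subbasis[OF S x(2)] by blast
    show "\<exists>T. openin X T \<and> x \<in> T \<and> T \<subseteq> {x \<in> E. g x \<in> S}"
      by (rule exI[of _ "{x \<in> E. g x \<in> U} \<inter> {x \<in> E. g x \<in> V}"])
        (use UV x assms(2) in \<open>auto intro!: openin_Int\<close>)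
  qed
qed

context
  fixes \<psi> assumes \<psi>: "side_aut \<psi>"
begin

lemma side_aut_mem: "U \<in> P \<Longrightarrow> \<psi> U \<in> P"
  and side_aut_compl: "U \<in> P \<Longrightarrow> \<psi> (E - U) = E - \<psi> U"
  and side_aut_subset: "U \<in> P \<Longrightarrow> V \<in> P \<Longrightarrow> \<psi> U \<subseteq> \<psi> V \<longleftrightarrow> U \<subseteq> V"
  using \<psi> by (auto simp: side_aut_def bij_betw_def)

lemma side_aut_surj:
  assumes "V \<in> P"
  shows "\<exists>U\<in>P. V = \<psi> U"
proof -
  have "V \<in> \<psi> ` P" using \<psi> assms by (simp add: side_aut_def bij_betw_def)
  then show ?thesis by blast
qed

text \<open>An intersection with two points is itself a side, hence the greatest lower bound in
  \<open>P\<close>, which an order automorphism preserves. Conversely,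
  \<open>\<psi> U \<inter> \<psi> V\<close>, if a side, pulls back to a side below \<open>U\<close>
  and \<open>V\<close>.\<close>

lemma side_aut_two_points_Int:
  assumes "U \<in> P" "V \<in> P"
  shows "two_points (\<psi> U \<inter> \<psi> V) \<longleftrightarrow> two_points (U \<inter> V)"
    and "two_points (U \<inter> V) \<Longrightarrow> \<psi> (U \<inter> V) = \<psi> U \<inter> \<psi> V"
proof -
  have 1: "\<psi> (U \<inter> V) \<subseteq> \<psi> U \<inter> \<psi> V" if "two_points (U \<inter> V)"
    using cut_sides_Int[OF assms that] assms side_aut_subset by auto
  have 2: "\<exists>T\<in>P. \<psi> T = \<psi> U \<inter> \<psi> V \<and> T \<subseteq> U \<inter> V" if two: "two_points (\<psi> U \<inter> \<psi> V)"
  proof -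
    obtain T where "T \<in> P" "\<psi> U \<inter> \<psi> V = \<psi> T"
      using side_aut_surj[OF cut_sides_Int[OF side_aut_mem side_aut_mem two]] assms by blast
    then show ?thesis using side_aut_subset assms by (metis Int_lower1 Int_lower2 le_inf_iff)
  qed
  show iff: "two_points (\<psi> U \<inter> \<psi> V) \<longleftrightarrow> two_points (U \<inter> V)"
  proof
    assume "two_points (\<psi> U \<inter> \<psi> V)"
    then show "two_points (U \<inter> V)" using 2 cut_sidesD(4) two_points_mono by blast
  next
    assume *: "two_points (U \<inter> V)"
    then have "two_points (\<psi> (U \<inter> V))"
      using cut_sidesD(4)[OF side_aut_mem[OF cut_sides_Int[OF assms]]] by blast
    then show "two_points (\<psi> U \<inter> \<psi> V)" using 1[OF *] two_points_mono by blast
  qed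
  assume *: "two_points (U \<inter> V)"
  then obtain T where T: "T \<in> P" "\<psi> T = \<psi> U \<inter> \<psi> V" "T \<subseteq> U \<inter> V" using 2 iff by blast
  then have "\<psi> T \<subseteq> \<psi> (U \<inter> V)" using side_aut_subset[OF _ cut_sides_Int[OF assms *]] by blast
  with 1[OF *] T(2) show "\<psi> (U \<inter> V) = \<psi> U \<inter> \<psi> V" by (metis subset_antisym)
qed

text \<open>Every open neighborhood of a non-isolated point has a second point, so finite
  intersections never leave \<open>P\<close> and \<psi> applies to them.\<close>

lemma side_aut_Inter:
  assumes "\<not> openin X {x}" "finite G" "G \<noteq> {}" "\<forall>W\<in>G. W \<in> P \<and> x \<in> W"
  shows "\<Inter>G \<in> P \<and> x \<in> \<Inter>G \<and> \<psi> (\<Inter>G) = \<Inter>(\<psi> ` G)"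
  using assms(2-)
proof (induction G rule: finite_ne_induct)
  case (singleton W)
  then show ?case by simp
next
  case (insert W G)
  then have W: "W \<in> P" "x \<in> W" and G: "\<Inter>G \<in> P" "x \<in> \<Inter>G" "\<psi> (\<Inter>G) = \<Inter>(\<psi> ` G)" by auto
  have "openin X (W \<inter> \<Inter>G)" using cut_sidesD(1)[OF W(1)] cut_sidesD(1)[OF G(1)] by (rule openin_Int)
  then have "W \<inter> \<Inter>G \<noteq> {x}" using assms(1) by metis
  then have tp: "two_points (W \<inter> \<Inter>G)" using W(2) G(2) unfolding two_points_def by blast
  show ?case
    using cut_sides_Int[OF W(1) G(1) tp] side_aut_two_points_Int(2)[OF W(1) G(1) tp] W(2) G(2,3) by simp
qed

text \<open>Here \<open>U\<close> and \<open>V\<close> single out \<open>x\<close>, and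
  \<open>y\<close> is the candidate for its image. The extra point \<open>z\<close> makes
  \<open>U \<inter> W\<close> a side, to which \<psi> can be applied.\<close>

lemma side_aut_isolated_point:
  assumes U: "U \<in> P" and V: "V \<in> P" and W: "W \<in> P" and UV: "U \<inter> V = {x}" and tp: "two_points (U - V)"
    and y: "y \<in> \<psi> U" "y \<in> \<psi> V" and z: "x \<in> W" "z \<in> W" "z \<in> U" "z \<noteq> x"
  shows "y \<in> \<psi> W"
proof (rule ccontr)
  assume nW: "y \<notin> \<psi> W"
  have "\<not> two_points (\<psi> U \<inter> \<psi> V)"
    unfolding side_aut_two_points_Int(1)[OF U V] UV by (simp add: two_points_def)
  then have only: "\<psi> U \<inter> \<psi> V \<subseteq> {y}" using y unfolding two_points_def by blast
  have CV: "E - V \<in> P" using V by (rule cut_sides_compl)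
  have UE: "U \<subseteq> E" "\<psi> U \<subseteq> E" using U side_aut_mem[OF U] cut_sidesD(3) by auto
  have d: "U \<inter> (E - V) = U - V" using UE by blast
  have tW: "two_points (U \<inter> W)" using z UV unfolding two_points_def by blast
  \<comment> \<open>\<open>y\<close> is the only point of \<open>\<psi> U \<inter> \<psi> V\<close> and avoids \<open>\<psi> W\<close>, so \<open>\<psi> U \<inter> \<psi> W\<close> misses \<open>\<psi> V\<close>.\<close>
  have "\<psi> (U \<inter> W) \<subseteq> \<psi> (U \<inter> (E - V))"
    using side_aut_two_points_Int(2)[OF U W tW] side_aut_two_points_Int(2)[OF U CV] side_aut_compl[OF V] only nW tp d UE
    by auto
  then have "U \<inter> W \<subseteq> U \<inter> (E - V)"
    using side_aut_subset[OF cut_sides_Int[OF U W tW] cut_sides_Int[OF U CV]] tp d by simp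
  then show False using z(1) UV by blast
qed

text \<open>The image of \<open>x\<close> is sought in the intersection of all
  \<open>\<psi> W\<close> with \<open>x \<in> W\<close>. At an isolated point two sides already
  locate it; elsewhere compactness does.\<close>

lemma side_aut_point:
  assumes x: "x \<in> E"
  shows "\<exists>y\<in>E. \<forall>W\<in>P. x \<in> W \<longrightarrow> y \<in> \<psi> W"
proof (cases "openin X {x}")
  case True
  then obtain U V where UV: "U \<in> P" "V \<in> P" "U \<inter> V = {x}" "U \<union> V = E" "two_points (U - V)" "two_points (V - U)"
    using isolated_point_partition by blast
  have "\<psi> U \<inter> \<psi> V \<noteq> {}"
  proof
    assume "\<psi> U \<inter> \<psi> V = {}"
    then have "\<psi> U \<subseteq> \<psi> (E - V)"
      using side_aut_compl[OF UV(2)] cut_sidesD(3)[OF side_aut_mem[OF UV(1)]] by blast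
    then have "U \<subseteq> E - V" using side_aut_subset[OF UV(1) cut_sides_compl[OF UV(2)]] by simp
    then show False using UV(3) by blast
  qed
  then obtain y where y: "y \<in> \<psi> U" "y \<in> \<psi> V" by blast
  have "y \<in> \<psi> W" if W: "W \<in> P" "x \<in> W" for W
  proof -
    obtain z where z: "z \<in> W" "z \<noteq> x" using cut_sidesD(4)[OF W(1)] by (auto simp: two_points_def)
    \<comment> \<open>The second point of \<open>W\<close> lies in \<open>U\<close> or in
      \<open>V\<close>, since they cover \<open>E\<close>; the isolated-point lemma is applied with
      the roles of \<open>U\<close> and \<open>V\<close> chosen accordingly.\<close>
    then have "z \<in> U \<or> z \<in> V" using UV(4) cut_sidesD(3)[OF W(1)] by blast
    then show ?thesis
      using side_aut_isolated_point[OF UV(1,2) W(1) UV(3,5) y W(2) z(1) _ z(2)]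
        side_aut_isolated_point[OF UV(2,1) W(1) _ UV(6) y(2,1) W(2) z(1) _ z(2)] UV(3)
      by (auto simp: Int_commute)
  qed
  moreover have "y \<in> E" using y(1) cut_sidesD(3)[OF side_aut_mem[OF UV(1)]] by blast
  ultimately show ?thesis by blast
next
  case False
  define \<W> where "\<W> = {W \<in> P. x \<in> W}"
  \<comment> \<open>Finitely many sets \<open>\<psi> W\<close> meet in the image of one side, which
    is nonempty; the empty family has the whole type as its intersection.\<close>
  have fip: "\<Inter>\<F> \<noteq> {}" if \<F>: "finite \<F>" "\<F> \<subseteq> \<psi> ` \<W>" for \<F>
  proof (cases "\<F> = {}")
    case False
    obtain G where G: "G \<subseteq> \<W>" "finite G" "\<F> = \<psi> ` G"
      using finite_subset_image[OF \<F>] by blast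
    have "\<Inter>G \<in> P \<and> x \<in> \<Inter>G \<and> \<psi> (\<Inter>G) = \<Inter>(\<psi> ` G)"
      using G False by (intro side_aut_Inter[OF \<open>\<not> openin X {x}\<close>]) (auto simp: \<W>_def)
    then show ?thesis using G(3) cut_sidesD(6)[OF side_aut_mem] by metis
  qed simp
  have "\<forall>C\<in>\<psi> ` \<W>. closedin X C" by (auto simp: \<W>_def intro!: cut_sidesD(2) side_aut_mem)
  then have "\<Inter>(\<psi> ` \<W>) \<noteq> {}"
    using compact fip unfolding compact_space_fip by blast
  then obtain y where y: "\<And>W. W \<in> P \<Longrightarrow> x \<in> W \<Longrightarrow> y \<in> \<psi> W" by (auto simp: \<W>_def)
  obtain W where "W \<in> P" "x \<in> W" by (rule subbasis[OF openin_topspace x]) (rule that)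
  then have "y \<in> E" using y cut_sidesD(3)[OF side_aut_mem] by blast
  with y show ?thesis by blast
qed

lemma side_aut_point_map:
  obtains g where "\<And>x. x \<in> E \<Longrightarrow> g x \<in> E" "\<And>x. x \<notin> E \<Longrightarrow> g x = x"
    "\<And>x W. x \<in> E \<Longrightarrow> W \<in> P \<Longrightarrow> g x \<in> \<psi> W \<longleftrightarrow> x \<in> W"
proof -
  obtain g0 where g0: "\<And>x. x \<in> E \<Longrightarrow> g0 x \<in> E \<and> (\<forall>W\<in>P. x \<in> W \<longrightarrow> g0 x \<in> \<psi> W)"
    using side_aut_point by metis
  \<comment> \<open>Using the implication for \<open>E - W\<close> as well turns it into an
    equivalence.\<close>
  have "g0 x \<in> \<psi> W \<longleftrightarrow> x \<in> W" if "x \<in> E" "W \<in> P" for x W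
    using g0[OF that(1)] cut_sides_compl[OF that(2)] side_aut_compl[OF that(2)] that by blast
  with g0 show ?thesis by (intro that[of "\<lambda>x. if x \<in> E then g0 x else x"]) auto
qed

lemma continuous_side_aut_point_map:
  assumes "\<And>x. x \<in> E \<Longrightarrow> g x \<in> E" "\<And>x W. x \<in> E \<Longrightarrow> W \<in> P \<Longrightarrow> g x \<in> \<psi> W \<longleftrightarrow> x \<in> W"
  shows "continuous_map X X g"
proof (rule continuous_map_cut_sidesI)
  fix V assume "V \<in> P"
  then obtain U where U: "U \<in> P" "V = \<psi> U" using side_aut_surj by blast
  have "{x \<in> E. g x \<in> V} = U" using assms(2) U cut_sidesD(3)[OF U(1)] by blast
  then show "openin X {x \<in> E. g x \<in> V}" using cut_sidesD(1)[OF U(1)] by simp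
qed (use assms in auto)

end

lemma homeo_of_side_aut:
  assumes \<psi>: "side_aut \<psi>"
  obtains g where "g \<in> homeo_group X" "\<And>W. W \<in> P \<Longrightarrow> g ` W = \<psi> W"
proof -
  let ?i = "inv_into P \<psi>"
  have i: "side_aut ?i" using \<psi> by (rule side_aut_inv_into)
  obtain g where g: "\<And>x. x \<in> E \<Longrightarrow> g x \<in> E" "\<And>x. x \<notin> E \<Longrightarrow> g x = x"
    "\<And>x W. x \<in> E \<Longrightarrow> W \<in> P \<Longrightarrow> g x \<in> \<psi> W \<longleftrightarrow> x \<in> W" using side_aut_point_map[OF \<psi>] by blast
  obtain h where h: "\<And>x. x \<in> E \<Longrightarrow> h x \<in> E" "\<And>x. x \<notin> E \<Longrightarrow> h x = x"
    "\<And>x W. x \<in> E \<Longrightarrow> W \<in> P \<Longrightarrow> h x \<in> ?i W \<longleftrightarrow> x \<in> W" using side_aut_point_map[OF i] by blast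
  have bij: "bij_betw \<psi> P P" using \<psi> by (simp add: side_aut_def)
  note il = bij_betw_inv_into_left[OF bij] and ir = bij_betw_inv_into_right[OF bij]
  \<comment> \<open>The point \<open>h (g x)\<close> lies in the same sides as \<open>x\<close>, and
    sides separate points.\<close>
  have hg: "h (g x) = x" if x: "x \<in> E" for x
  proof (rule ccontr)
    assume "h (g x) \<noteq> x"
    then obtain W where W: "W \<in> P" "h (g x) \<in> W" "x \<notin> W"
      using separates_points[OF h(1)[OF g(1)[OF x]] x] by blast
    then show False
      using h(3)[OF g(1)[OF that] side_aut_mem[OF \<psi> W(1)]] g(3)[OF that W(1)] il[OF W(1)] by simp
  qed
  have gh: "g (h x) = x" if x: "x \<in> E" for x
  proof (rule ccontr)
    assume "g (h x) \<noteq> x"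
    then obtain W where W: "W \<in> P" "g (h x) \<in> W" "x \<notin> W"
      using separates_points[OF g(1)[OF h(1)[OF x]] x] by blast
    then show False
      using g(3)[OF h(1)[OF that] side_aut_mem[OF i W(1)]] h(3)[OF that W(1)] ir[OF W(1)] by simp
  qed
  have "homeomorphic_maps X X g h"
    unfolding homeomorphic_maps_def
    using continuous_side_aut_point_map[OF \<psi> g(1,3)] continuous_side_aut_point_map[OF i h(1,3)] gh hg by blast
  then have "g \<in> homeo_group X" using g(2) unfolding homeo_group_def homeomorphic_map_maps by blast
  moreover have "g ` W = \<psi> W" if W: "W \<in> P" for W
  proof (intro equalityI subsetI)
    fix y assume "y \<in> g ` W"
    then show "y \<in> \<psi> W" using g(3)[OF _ W] cut_sidesD(3)[OF W] by blast
  next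
    fix y assume y: "y \<in> \<psi> W"
    then have "y \<in> E" using cut_sidesD(3)[OF side_aut_mem[OF \<psi> W]] by blast
    then have "g (h y) = y" "h y \<in> W" using gh h(1) g(3)[OF h(1) W] y by auto
    then show "y \<in> g ` W" by (metis imageI)
  qed
  ultimately show ?thesis using that by blast
qed

end

subsection \<open>The permutation and compact-open topologies\<close>

lemma istopology_perm:
  "istopology (\<lambda>U. U \<subseteq> cut_complex_aut X \<and>
      (\<forall>g\<in>U. \<exists>F. finite F \<and> F \<subseteq> cut_vertices X \<and>
          {\<phi>\<in>cut_complex_aut X. \<forall>v\<in>F. \<phi> v = g v} \<subseteq> U))"
  (is "istopology (\<lambda>U. U \<subseteq> ?A \<and> (\<forall>g\<in>U. ?nbhd g U))")
proof -
  have Int: "?nbhd g (S \<inter> T)" if "?nbhd g S" "?nbhd g T" for g S T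
  proof -
    obtain F G where "finite F" "F \<subseteq> cut_vertices X" "{\<phi>\<in>?A. \<forall>v\<in>F. \<phi> v = g v} \<subseteq> S"
      "finite G" "G \<subseteq> cut_vertices X" "{\<phi>\<in>?A. \<forall>v\<in>G. \<phi> v = g v} \<subseteq> T"
      using \<open>?nbhd g S\<close> \<open>?nbhd g T\<close> by (elim exE conjE) (rule that)
    then show ?thesis by (intro exI[of _ "F \<union> G"]) auto
  qed
  have mono: "?nbhd g T" if "?nbhd g S" "S \<subseteq> T" for g S T
    using that by (meson subset_trans)
  show ?thesis
    unfolding istopology_def
  proof (intro conjI allI impI ballI)
    fix S T g
    assume ST: "S \<subseteq> ?A \<and> (\<forall>g\<in>S. ?nbhd g S)" "T \<subseteq> ?A \<and> (\<forall>g\<in>T. ?nbhd g T)"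
    show "S \<inter> T \<subseteq> ?A" using ST by blast
    assume "g \<in> S \<inter> T"
    then show "?nbhd g (S \<inter> T)" using ST by (intro Int) auto
  next
    fix \<K> g
    assume K: "\<forall>K\<in>\<K>. K \<subseteq> ?A \<and> (\<forall>g\<in>K. ?nbhd g K)"
    show "\<Union>\<K> \<subseteq> ?A" using K by blast
    assume "g \<in> \<Union>\<K>"
    then obtain K where "K \<in> \<K>" "g \<in> K" by blast
    then show "?nbhd g (\<Union>\<K>)" using K by (intro mono[of g K "\<Union>\<K>"]) auto
  qed
qed

lemma openin_perm_topology:
  "openin (perm_topology X) U \<longleftrightarrow> U \<subseteq> cut_complex_aut X \<and>
      (\<forall>g\<in>U. \<exists>F. finite F \<and> F \<subseteq> cut_vertices X \<and>
          {\<phi>\<in>cut_complex_aut X. \<forall>v\<in>F. \<phi> v = g v} \<subseteq> U)"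
  unfolding perm_topology_def topology_inverse'[OF istopology_perm] ..

lemma topspace_perm_topology: "topspace (perm_topology X) = cut_complex_aut X"
proof
  show "topspace (perm_topology X) \<subseteq> cut_complex_aut X"
    using openin_topspace[of "perm_topology X"] unfolding openin_perm_topology by blast
  have "openin (perm_topology X) (cut_complex_aut X)"
    unfolding openin_perm_topology by (auto intro: exI[of _ "{}"])
  then show "cut_complex_aut X \<subseteq> topspace (perm_topology X)" by (rule openin_subset)
qed

lemma topspace_compact_open_homeo: "topspace (compact_open_homeo X) = homeo_group X"
proof -
  \<comment> \<open>An empty \<open>K\<close> imposes no condition, so the subbasis covers the
    function type.\<close>
  have "UNIV \<in> {{f. f ` K \<subseteq> U} | K U. compactin X K \<and> openin X U}"
    by (rule CollectI, rule exI[of _ "{}"], rule exI[of _ "{}"]) simp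
  then have "\<Union>{{f. f ` K \<subseteq> U} | K U. compactin X K \<and> openin X U} = UNIV" by blast
  then show ?thesis unfolding compact_open_homeo_def topspace_subtopology topology_generated_by_topspace by simp
qed

lemma openin_compact_open_homeo:
  assumes "compactin X K" "openin X U"
  shows "openin (compact_open_homeo X) {f \<in> homeo_group X. f ` K \<subseteq> U}"
proof -
  have "openin (topology_generated_by {{f. f ` K \<subseteq> U} | K U. compactin X K \<and> openin X U}) {f. f ` K \<subseteq> U}"
    by (rule topology_generated_by_Basis) (use assms in blast)
  then show ?thesis
    unfolding compact_open_homeo_def openin_subtopology
    by (rule exI[where x = "{f. f ` K \<subseteq> U}", OF conjI]) blast
qed

subsection \<open>The homomorphism from homeomorphisms to automorphisms\<close>

lemma cut_vertex_member: "c \<in> cut_vertices X \<Longrightarrow> A \<in> c \<Longrightarrow> A \<in> cut_sides X"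
  by (auto simp: cut_vertices_eq cut_of_def cut_sides_compl)

lemma homeo_group_simps:
  assumes "f \<in> homeo_group X"
  shows "f ` topspace X = topspace X" "inj_on f (topspace X)"
    "openin X S \<Longrightarrow> openin X (f ` S)" "closedin X S \<Longrightarrow> closedin X (f ` S)" "continuous_map X X f"
  using assms by (simp_all add: homeo_group_def homeomorphic_eq_everything_map open_map_def closed_map_def)

lemma homeo_group_image_compl:
  assumes "f \<in> homeo_group X" "W \<subseteq> topspace X"
  shows "f ` (topspace X - W) = topspace X - f ` W"
  using inj_on_image_set_diff[OF homeo_group_simps(2)[OF assms(1)], of "topspace X" W]
    homeo_group_simps(1)[OF assms(1)] assms(2) by simp

lemma homeo_group_image_subset_iff:
  assumes "f \<in> homeo_group X" "A \<subseteq> topspace X" "B \<subseteq> topspace X"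
  shows "f ` A \<subseteq> f ` B \<longleftrightarrow> A \<subseteq> B"
  using inj_on_image_subset_iff[OF homeo_group_simps(2)[OF assms(1)] assms(2,3)] .

lemma homeo_group_image_side:
  assumes f: "f \<in> homeo_group X" and W: "W \<in> cut_sides X"
  shows "f ` W \<in> cut_sides X"
proof -
  note D = cut_sidesD[OF W]
  have "two_points (f ` W)" "two_points (f ` (topspace X - W))"
    using two_points_image[OF inj_on_subset[OF homeo_group_simps(2)[OF f]]] D(3,4,5) by blast+
  then show ?thesis
    unfolding cut_sides_def using homeo_group_simps(3,4)[OF f] D(1,2) homeo_group_image_compl[OF f D(3)] by simp
qed

lemma induced_aut_cut_of:
  assumes f: "f \<in> homeo_group X" and W: "W \<in> cut_sides X"
  shows "induced_aut X f (cut_of X W) = cut_of X (f ` W)"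
  unfolding induced_aut_def using cut_of_vertex[OF W] homeo_group_image_compl[OF f cut_sidesD(3)[OF W]]
  by (simp add: cut_of_def)

lemma induced_aut_vertex:
  assumes "f \<in> homeo_group X" "c \<in> cut_vertices X"
  shows "induced_aut X f c \<in> cut_vertices X"
proof -
  obtain W where W: "W \<in> cut_sides X" "c = cut_of X W" using assms(2) by (auto simp: cut_vertices_eq)
  then show ?thesis
    using cut_of_vertex[OF homeo_group_image_side[OF assms(1) W(1)]] induced_aut_cut_of[OF assms(1) W(1)] by simp
qed

lemma induced_aut_comp:
  assumes "g \<in> homeo_group X"
  shows "induced_aut X (f \<circ> g) = induced_aut X f \<circ> induced_aut X g"
proof
  fix c
  show "induced_aut X (f \<circ> g) c = (induced_aut X f \<circ> induced_aut X g) c"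
  proof (cases "c \<in> cut_vertices X")
    case True
    then have "induced_aut X g c \<in> cut_vertices X" using induced_aut_vertex[OF assms] by blast
    with True show ?thesis by (simp add: induced_aut_def image_image image_comp comp_def)
  qed (simp add: induced_aut_def)
qed

lemma homeo_group_inverse:
  assumes f: "f \<in> homeo_group X"
  obtains g where "g \<in> homeo_group X" "g \<circ> f = id" "f \<circ> g = id"
proof -
  obtain h where h: "homeomorphic_maps X X f h"
    using f by (auto simp: homeo_group_def homeomorphic_map_maps)
  have fo: "f x = x" if "x \<notin> topspace X" for x using f that by (simp add: homeo_group_def)
  have fi: "f x \<in> topspace X" if "x \<in> topspace X" for x using homeo_group_simps(1)[OF f] that by blast
  have hh: "h (f x) = x" "f (h x) = x" if "x \<in> topspace X" for x
    using h that by (auto simp: homeomorphic_maps_def)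
  \<comment> \<open>The inverse \<open>h\<close> is arbitrary off \<open>topspace X\<close>. Making
    it the identity there puts it into \<open>homeo_group X\<close> and lets both equations hold as
    equations of functions.\<close>
  define g where "g = (\<lambda>x. if x \<in> topspace X then h x else x)"
  have "homeomorphic_map X X h" using h homeomorphic_maps_map by blast
  then have "homeomorphic_map X X g" by (rule homeomorphic_map_eq) (simp add: g_def)
  then have "g \<in> homeo_group X" by (simp add: homeo_group_def g_def)
  moreover have "g (f x) = x" "f (g x) = x" for x
    by (cases "x \<in> topspace X"; simp add: g_def fo fi hh)+
  then have "g \<circ> f = id" "f \<circ> g = id" by (simp_all add: fun_eq_iff)
  ultimately show ?thesis using that by blast
qed

lemma induced_aut_id: "induced_aut X id = id"
  by (auto simp: induced_aut_def fun_eq_iff)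

lemma induced_aut_cross:
  assumes f: "f \<in> homeo_group X" and c: "c \<in> cut_vertices X" and d: "d \<in> cut_vertices X"
  shows "cuts_cross (induced_aut X f c) (induced_aut X f d) \<longleftrightarrow> cuts_cross c d"
proof -
  have "f ` A \<inter> f ` B = f ` (A \<inter> B)" if "A \<in> c" "B \<in> d" for A B
  proof (rule inj_on_image_Int[OF homeo_group_simps(2)[OF f], symmetric])
    show "A \<subseteq> topspace X" "B \<subseteq> topspace X"
      using that cut_vertex_member[OF c] cut_vertex_member[OF d] cut_sidesD(3) by blast+
  qed
  then show ?thesis using c d by (simp add: induced_aut_def cuts_cross_def)
qed

lemma induced_aut_in_aut:
  assumes f: "f \<in> homeo_group X"
  shows "induced_aut X f \<in> cut_complex_aut X"
proof -
  obtain g where g: "g \<in> homeo_group X" "g \<circ> f = id" "f \<circ> g = id" using homeo_group_inverse[OF f] .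
  have inv: "induced_aut X g (induced_aut X f c) = c" "induced_aut X f (induced_aut X g c) = c" for c
    using induced_aut_comp[OF f, of g] induced_aut_comp[OF g(1), of f] g(2,3)
    by (simp_all add: induced_aut_id fun_eq_iff)
  have bij: "bij_betw (induced_aut X f) (cut_vertices X) (cut_vertices X)"
    by (rule bij_betw_byWitness[where f' = "induced_aut X g"])
      (use inv induced_aut_vertex[OF f] induced_aut_vertex[OF g(1)] in auto)
  moreover have "cut_adjacent X (induced_aut X f c) (induced_aut X f d) \<longleftrightarrow> cut_adjacent X c d"
    if "c \<in> cut_vertices X" "d \<in> cut_vertices X" for c d
    using that induced_aut_vertex[OF f] induced_aut_cross[OF f that] inv(1)
    unfolding cut_adjacent_def by metis
  ultimately show ?thesis by (simp add: cut_complex_aut_def induced_aut_def)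
qed

section \<open>Bijectivity and bicontinuity of the induced map\<close>

context large_stone_space
begin

text \<open>Surjectivity: \<phi> is oriented to a map of sides, which a homeomorphism realizes; off
  the vertices both maps are the identity by convention.\<close>

lemma aut_is_induced:
  assumes \<phi>: "\<phi> \<in> cut_complex_aut X"
  shows "\<exists>f\<in>homeo_group X. induced_aut X f = \<phi>"
proof -
  obtain \<psi> where \<psi>: "side_aut \<psi>" "\<And>U. U \<in> P \<Longrightarrow> \<phi> (cut U) = cut (\<psi> U)"
    using side_aut_of_aut[OF \<phi>] by blast
  obtain f where f: "f \<in> homeo_group X" "\<And>W. W \<in> P \<Longrightarrow> f ` W = \<psi> W"
    using homeo_of_side_aut[OF \<psi>(1)] by blast
  have "induced_aut X f c = \<phi> c" for c
  proof (cases "c \<in> cut_vertices X")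
    case True
    then obtain W where "W \<in> P" "c = cut W" by (auto simp: cut_vertices_eq)
    then show ?thesis using induced_aut_cut_of[OF f(1)] f(2) \<psi>(2) by simp
  next
    case False
    then show ?thesis using \<phi> by (simp add: cut_complex_aut_def induced_aut_def)
  qed
  with f(1) show ?thesis by blast
qed

text \<open>Agreement on \<open>cut W\<close> leaves the same image of \<open>W\<close> or the
  complementary one. In the latter case the images of \<open>D\<close> are disjoint, hence distinct;
  were they complementary too, \<open>f\<close> would map \<open>W\<close> into the image of
  \<open>D\<close>, against \<open>D \<subset> W\<close>.\<close>

lemma image_side_determined_by_subside:
  assumes W: "W \<in> P" and D: "D \<in> P" "D \<subset> W" and f: "f \<in> homeo_group X" and f': "f' \<in> homeo_group X"
    and eq: "induced_aut X f (cut W) = induced_aut X f' (cut W)" "induced_aut X f (cut D) = induced_aut X f' (cut D)"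
  shows "f ` W = f' ` W"
proof (rule ccontr)
  assume ne: "f ` W \<noteq> f' ` W"
  note DE = cut_sidesD(3)[OF D(1)] and WE = cut_sidesD(3)[OF W]
  have "cut (f ` W) = cut (f' ` W)" "cut (f ` D) = cut (f' ` D)"
    using eq induced_aut_cut_of[OF f] induced_aut_cut_of[OF f'] W D(1) by auto
  then have W': "f' ` W = E - f ` W" and D': "f' ` D = f ` D \<or> f' ` D = E - f ` D"
    using cut_of_eq_iff[OF homeo_group_image_side[OF f]] W D(1) ne by auto
  have fD: "f ` D \<subseteq> f ` W" "f' ` D \<subseteq> f' ` W" using D(2) by auto
  have ne0: "f ` D \<noteq> {}" using cut_sidesD(6)[OF D(1)] by simp
  from D' show False
  proof
    assume "f' ` D = f ` D"
    then show False using fD W' ne0 by blast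
  next
    assume "f' ` D = E - f ` D"
    then have "E - f ` D \<subseteq> E - f ` W" using fD(2) W' by simp
    moreover have "f ` W \<subseteq> E" using cut_sidesD(3)[OF homeo_group_image_side[OF f W]] .
    ultimately have "f ` W \<subseteq> f ` D" by blast
    then show False using homeo_group_image_subset_iff[OF f WE DE] D(2) by blast
  qed
qed

text \<open>One cut leaves the orientation open; a second cut on either side of it, which
  \<open>proper_subside_or\<close> provides, fixes it.\<close>

lemma finitely_many_cuts_determine_image:
  assumes W: "W \<in> P"
  shows "\<exists>F. finite F \<and> F \<subseteq> cut_vertices X \<and> (\<forall>f\<in>homeo_group X. \<forall>f'\<in>homeo_group X.
      (\<forall>v\<in>F. induced_aut X f v = induced_aut X f' v) \<longrightarrow> f ` W = f' ` W)"
proof -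
  obtain D where D: "D \<in> P" "D \<subset> W \<or> D \<subset> E - W"
    using proper_subside_or[OF W] by blast
  have "f ` W = f' ` W" if f: "f \<in> homeo_group X" and f': "f' \<in> homeo_group X"
    and eq: "\<forall>v\<in>{cut W, cut D}. induced_aut X f v = induced_aut X f' v" for f f'
    using D(2)
  proof
    assume "D \<subset> W"
    then show ?thesis
      using image_side_determined_by_subside[OF W D(1) _ f f'] eq by simp
  next
    assume "D \<subset> E - W"
    then have "f ` (E - W) = f' ` (E - W)"
      using image_side_determined_by_subside[OF cut_sides_compl[OF W] D(1) _ f f'] eq cut_of_compl[OF W] by simp
    moreover have "f ` W = E - f ` (E - W)" "f' ` W = E - f' ` (E - W)"
      using homeo_group_image_compl[OF f, of "E - W"] homeo_group_image_compl[OF f', of "E - W"]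
        cut_sides_diff_diff[OF W] by simp_all
    ultimately show ?thesis by simp
  qed
  then show ?thesis
    using cut_of_vertex[OF W] cut_of_vertex[OF D(1)] by (intro exI[of _ "{cut W, cut D}"]) blast
qed

lemma inj_on_induced_aut: "inj_on (induced_aut X) (homeo_group X)"
proof (rule inj_onI)
  fix f f' assume f: "f \<in> homeo_group X" and f': "f' \<in> homeo_group X" and eq: "induced_aut X f = induced_aut X f'"
  show "f = f'"
  proof
    fix x
    show "f x = f' x"
    proof (cases "x \<in> E")
      case False
      then show ?thesis using f f' by (simp add: homeo_group_def)
    next
      case x: True
      show ?thesis
      proof (rule ccontr)
        assume ne: "f x \<noteq> f' x"
        have "f x \<in> E" "f' x \<in> E" using homeo_group_simps(1)[OF f] homeo_group_simps(1)[OF f'] x by auto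
        then have "openin X (E - {f' x})" "f x \<in> E - {f' x}"
          using closedin_finite[of "{f' x}"] ne by auto
        then have "openin X {z \<in> E. f z \<in> E - {f' x}}"
          using openin_continuous_map_preimage[OF homeo_group_simps(5)[OF f]] by blast
        \<comment> \<open>\<open>U\<close> and \<open>V\<close> are chosen so that \<open>f\<close>
          maps their intersection away from \<open>f' x\<close>, yet equal images of sides force
          \<open>f' x\<close> into the image of that intersection.\<close>
        then obtain U V where UV: "U \<in> P" "V \<in> P" "x \<in> U" "x \<in> V" "U \<inter> V \<subseteq> {z \<in> E. f z \<in> E - {f' x}}"
          using subbasis[of "{z \<in> E. f z \<in> E - {f' x}}" x] x \<open>f x \<in> E - {f' x}\<close> by blast
        have same: "f ` W = f' ` W" if "W \<in> P" for W
          using finitely_many_cuts_determine_image[OF that] f f' by (metis eq)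
        have "f' x \<in> f ` U \<inter> f ` V" using same UV by blast
        also have "\<dots> = f ` (U \<inter> V)"
          using inj_on_image_Int[OF homeo_group_simps(2)[OF f]] cut_sidesD(3) UV(1,2) by metis
        finally obtain z where "f' x = f z" "z \<in> U \<inter> V" by (rule imageE)
        then show False using UV(5) by auto
      qed
    qed
  qed
qed

text \<open>Sides are compact and their images under \<open>f\<^sub>0\<close> are open, so each
  condition is subbasic in the compact-open topology.\<close>

lemma openin_image_subset_sides:
  assumes "finite \<W>" "\<W> \<subseteq> P" "f\<^sub>0 \<in> homeo_group X"
  shows "openin (compact_open_homeo X) {f \<in> homeo_group X. \<forall>W\<in>\<W>. f ` W \<subseteq> f\<^sub>0 ` W}"
  using assms(1,2)
proof (induction \<W> rule: finite_induct)
  case empty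
  then show ?case using openin_topspace[of "compact_open_homeo X"] by (simp add: topspace_compact_open_homeo)
next
  case (insert W \<W>)
  have "openin (compact_open_homeo X) {f \<in> homeo_group X. f ` W \<subseteq> f\<^sub>0 ` W}"
    using insert.prems cut_sidesD(1,2)[of W X]
    by (intro openin_compact_open_homeo compactin_closed homeo_group_simps(3)[OF assms(3)]) auto
  moreover have "{f \<in> homeo_group X. \<forall>W\<in>insert W \<W>. f ` W \<subseteq> f\<^sub>0 ` W} =
    {f \<in> homeo_group X. f ` W \<subseteq> f\<^sub>0 ` W} \<inter> {f \<in> homeo_group X. \<forall>W\<in>\<W>. f ` W \<subseteq> f\<^sub>0 ` W}" by blast
  ultimately show ?case using insert by (simp add: openin_Int)
qed

lemma continuous_map_induced_aut:
  "continuous_map (compact_open_homeo X) (perm_topology X) (induced_aut X)"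
  unfolding continuous_map_def topspace_compact_open_homeo topspace_perm_topology
proof (intro conjI allI impI)
  show "induced_aut X \<in> homeo_group X \<rightarrow> cut_complex_aut X" using induced_aut_in_aut by blast
  fix S assume S: "openin (perm_topology X) S"
  show "openin (compact_open_homeo X) {f \<in> homeo_group X. induced_aut X f \<in> S}"
  proof (subst openin_subopen, intro ballI)
    fix f\<^sub>0 assume "f\<^sub>0 \<in> {f \<in> homeo_group X. induced_aut X f \<in> S}"
    then have f0: "f\<^sub>0 \<in> homeo_group X" "induced_aut X f\<^sub>0 \<in> S" by auto
    obtain F where F: "finite F" "F \<subseteq> cut_vertices X"
      "{\<phi> \<in> cut_complex_aut X. \<forall>v\<in>F. \<phi> v = induced_aut X f\<^sub>0 v} \<subseteq> S"
      using S f0(2) unfolding openin_perm_topology by blast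
    \<comment> \<open>\<open>\<Union>F\<close> contains both sides of each cut in \<open>F\<close>;
      inclusions for a side and for its complement together force equality.\<close>
    define N where "N = {f \<in> homeo_group X. \<forall>W\<in>\<Union>F. f ` W \<subseteq> f\<^sub>0 ` W}"
    have "\<Union>F \<subseteq> P" using F(2) cut_vertex_member by blast
    moreover have "finite (\<Union>F)"
    proof (rule finite_Union[OF F(1)])
      fix c assume "c \<in> F"
      then obtain W where "c = cut W" using F(2) by (auto simp: cut_vertices_eq)
      then show "finite c" by (simp add: cut_of_def)
    qed
    ultimately have "openin (compact_open_homeo X) N"
      unfolding N_def by (intro openin_image_subset_sides f0(1))
    moreover have "f\<^sub>0 \<in> N" using f0 by (simp add: N_def)
    moreover have "induced_aut X f \<in> S" if f: "f \<in> N" for f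
    proof -
      have fh: "f \<in> homeo_group X" using f by (simp add: N_def)
      have "induced_aut X f c = induced_aut X f\<^sub>0 c" if c: "c \<in> F" for c
      proof -
        obtain W where W: "W \<in> P" "c = cut W" using c F(2) by (auto simp: cut_vertices_eq)
        have "f ` W \<subseteq> f\<^sub>0 ` W" "f ` (E - W) \<subseteq> f\<^sub>0 ` (E - W)"
          using f c W(2) by (auto simp: N_def cut_of_def)
        moreover have "f\<^sub>0 ` W \<subseteq> E" using cut_sidesD(3)[OF homeo_group_image_side[OF f0(1) W(1)]] .
        moreover have "E - f ` W \<subseteq> E - f\<^sub>0 ` W"
          using calculation(2) homeo_group_image_compl[OF fh cut_sidesD(3)[OF W(1)]]
            homeo_group_image_compl[OF f0(1) cut_sidesD(3)[OF W(1)]] by simp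
        ultimately have "f ` W = f\<^sub>0 ` W" by blast
        then show ?thesis using induced_aut_cut_of[OF fh W(1)] induced_aut_cut_of[OF f0(1) W(1)] W(2) by simp
      qed
      then show ?thesis using F(3) induced_aut_in_aut[OF fh] by blast
    qed
    ultimately show "\<exists>T. openin (compact_open_homeo X) T \<and> f\<^sub>0 \<in> T \<and> T \<subseteq> {f \<in> homeo_group X. induced_aut X f \<in> S}"
      by (intro exI[of _ N]) (auto simp: N_def)
  qed
qed

text \<open>\<open>K\<close> is covered by intersections of two sides that \<open>f\<^sub>0\<close>
  maps into \<open>U\<close>. Finitely many of them suffice, and finitely many cuts control the
  image of each.\<close>

lemma compact_open_nbhd:
  assumes K: "compactin X K" and U: "openin X U" and f0: "f\<^sub>0 \<in> homeo_group X" "f\<^sub>0 ` K \<subseteq> U"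
  shows "\<exists>F. finite F \<and> F \<subseteq> cut_vertices X \<and>
    (\<forall>f\<in>homeo_group X. (\<forall>v\<in>F. induced_aut X f v = induced_aut X f\<^sub>0 v) \<longrightarrow> f ` K \<subseteq> U)"
proof -
  define O' where "O' = {x \<in> E. f\<^sub>0 x \<in> U}"
  have O': "openin X O'" unfolding O'_def
    using openin_continuous_map_preimage[OF homeo_group_simps(5)[OF f0(1)] U] .
  have KE: "K \<subseteq> E" using K by (rule compactin_subset_topspace)
  \<comment> \<open>Inclusion is enough because \<open>f\<^sub>0\<close> maps the relevant
    \<open>T\<close> into \<open>U\<close>; it passes to intersections of two sides by injectivity
    of \<open>f\<^sub>0\<close>.\<close>
  define determines where "determines F T \<longleftrightarrow> finite F \<and> F \<subseteq> cut_vertices X \<and>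
      (\<forall>f\<in>homeo_group X. (\<forall>v\<in>F. induced_aut X f v = induced_aut X f\<^sub>0 v) \<longrightarrow> f ` T \<subseteq> f\<^sub>0 ` T)"
    for F :: "'a set set set" and T :: "'a set"
  have side: "\<exists>F. determines F A" if A: "A \<in> P" for A
    using finitely_many_cuts_determine_image[OF A] f0(1) unfolding determines_def by (metis order_refl)
  define \<C> where "\<C> = {T. openin X T \<and> T \<subseteq> O' \<and> (\<exists>F. determines F T)}"
  have "K \<subseteq> \<Union>\<C>"
  proof
    fix x assume "x \<in> K"
    then have "x \<in> O'" using KE f0(2) by (auto simp: O'_def)
    then obtain A B where AB: "A \<in> P" "B \<in> P" "x \<in> A" "x \<in> B" "A \<inter> B \<subseteq> O'" using subbasis[OF O'] by blast
    obtain F where F: "determines F A" using side[OF AB(1)] ..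
    obtain G where G: "determines G B" using side[OF AB(2)] ..
    have inj: "f\<^sub>0 ` (A \<inter> B) = f\<^sub>0 ` A \<inter> f\<^sub>0 ` B"
      using inj_on_image_Int[OF homeo_group_simps(2)[OF f0(1)] cut_sidesD(3)[OF AB(1)] cut_sidesD(3)[OF AB(2)]] .
    have "determines (F \<union> G) (A \<inter> B)"
      unfolding determines_def inj
    proof (intro conjI ballI impI)
      fix f assume f: "f \<in> homeo_group X" "\<forall>v\<in>F \<union> G. induced_aut X f v = induced_aut X f\<^sub>0 v"
      then have "f ` A \<subseteq> f\<^sub>0 ` A" "f ` B \<subseteq> f\<^sub>0 ` B" using F G unfolding determines_def by simp_all
      then show "f ` (A \<inter> B) \<subseteq> f\<^sub>0 ` A \<inter> f\<^sub>0 ` B" by blast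
    qed (use F G in \<open>auto simp: determines_def\<close>)
    then have "A \<inter> B \<in> \<C>"
      unfolding \<C>_def using AB(5) openin_Int[OF cut_sidesD(1)[OF AB(1)] cut_sidesD(1)[OF AB(2)]] by blast
    then show "x \<in> \<Union>\<C>" using AB(3,4) by blast
  qed
  moreover have "openin X T" if "T \<in> \<C>" for T using that by (simp add: \<C>_def)
  ultimately obtain \<F> where \<F>: "finite \<F>" "\<F> \<subseteq> \<C>" "K \<subseteq> \<Union>\<F>"
    using compactinD[OF K, of \<C>] by blast
  have "\<forall>T\<in>\<F>. \<exists>F. determines F T" using \<F>(2) by (auto simp: \<C>_def)
  from bchoice[OF this] obtain F where F: "\<forall>T\<in>\<F>. determines (F T) T" ..
  show ?thesis
  proof (intro exI[of _ "\<Union>(F ` \<F>)"] conjI ballI impI)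
    show "finite (\<Union>(F ` \<F>))" "\<Union>(F ` \<F>) \<subseteq> cut_vertices X"
      using F \<F>(1) unfolding determines_def by auto
    fix f assume f: "f \<in> homeo_group X" "\<forall>v\<in>\<Union>(F ` \<F>). induced_aut X f v = induced_aut X f\<^sub>0 v"
    have "f ` T \<subseteq> U" if T: "T \<in> \<F>" for T
    proof -
      have "f ` T \<subseteq> f\<^sub>0 ` T" using F T f unfolding determines_def by simp
      also have "\<dots> \<subseteq> U" using T \<F>(2) by (auto simp: \<C>_def O'_def)
      finally show ?thesis .
    qed
    then show "f ` K \<subseteq> U" using \<F>(3) by blast
  qed
qed

text \<open>By induction on the generation of \<open>T\<close>: subbasic sets are
  \<open>compact_open_nbhd\<close>, an intersection unites two finite sets of cuts, and a union
  keeps that of one member.\<close>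

lemma generated_open_nbhd:
  assumes "generate_topology_on {{f. f ` K \<subseteq> U} | K U. compactin X K \<and> openin X U} T"
    and "f\<^sub>0 \<in> homeo_group X" "f\<^sub>0 \<in> T"
  shows "\<exists>F. finite F \<and> F \<subseteq> cut_vertices X \<and>
    (\<forall>f\<in>homeo_group X. (\<forall>v\<in>F. induced_aut X f v = induced_aut X f\<^sub>0 v) \<longrightarrow> f \<in> T)"
  using assms
proof (induction rule: generate_topology_on.induct)
  case Empty
  then show ?case by simp
next
  case (Int a b)
  have "f\<^sub>0 \<in> a" "f\<^sub>0 \<in> b" using Int.prems(2) by simp_all
  obtain F where F: "finite F" "F \<subseteq> cut_vertices X"
    "\<forall>f\<in>homeo_group X. (\<forall>v\<in>F. induced_aut X f v = induced_aut X f\<^sub>0 v) \<longrightarrow> f \<in> a"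
    using Int.IH(1)[OF Int.prems(1) \<open>f\<^sub>0 \<in> a\<close>] by (elim exE conjE) (rule that)
  obtain G where G: "finite G" "G \<subseteq> cut_vertices X"
    "\<forall>f\<in>homeo_group X. (\<forall>v\<in>G. induced_aut X f v = induced_aut X f\<^sub>0 v) \<longrightarrow> f \<in> b"
    using Int.IH(2)[OF Int.prems(1) \<open>f\<^sub>0 \<in> b\<close>] by (elim exE conjE) (rule that)
  show ?case by (intro exI[of _ "F \<union> G"] conjI ballI impI IntI) (use F G in auto)
next
  case (UN \<K>)
  then obtain k where k: "k \<in> \<K>" "f\<^sub>0 \<in> k" by blast
  obtain F where "finite F" "F \<subseteq> cut_vertices X"
    "\<forall>f\<in>homeo_group X. (\<forall>v\<in>F. induced_aut X f v = induced_aut X f\<^sub>0 v) \<longrightarrow> f \<in> k"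
    using UN.IH[OF k(1) UN.prems(1) k(2)] by (elim exE conjE) (rule that)
  with k(1) show ?case by (intro exI[of _ F]) auto
next
  case (Basis s)
  then obtain K U where s: "s = {f. f ` K \<subseteq> U}" "compactin X K" "openin X U" by blast
  show ?case using compact_open_nbhd[OF s(2,3) Basis.prems(1)] Basis.prems(2) unfolding s(1) by simp
qed

lemma open_map_induced_aut: "open_map (compact_open_homeo X) (perm_topology X) (induced_aut X)"
  unfolding open_map_def
proof (intro allI impI)
  fix S assume "openin (compact_open_homeo X) S"
  then obtain T where T: "generate_topology_on {{f. f ` K \<subseteq> U} | K U. compactin X K \<and> openin X U} T"
    "S = T \<inter> homeo_group X"
    unfolding compact_open_homeo_def openin_subtopology openin_topology_generated_by_iff by blast
  show "openin (perm_topology X) (induced_aut X ` S)"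
    unfolding openin_perm_topology
  proof (intro conjI ballI)
    show "induced_aut X ` S \<subseteq> cut_complex_aut X" using induced_aut_in_aut T(2) by blast
    fix g assume "g \<in> induced_aut X ` S"
    then obtain f0 where f0: "g = induced_aut X f0" "f0 \<in> homeo_group X" "f0 \<in> T" using T(2) by blast
    obtain F where F: "finite F" "F \<subseteq> cut_vertices X"
      "\<forall>f\<in>homeo_group X. (\<forall>v\<in>F. induced_aut X f v = induced_aut X f0 v) \<longrightarrow> f \<in> T"
      using generated_open_nbhd[OF T(1) f0(2,3)] by blast
    have "{\<phi> \<in> cut_complex_aut X. \<forall>v\<in>F. \<phi> v = g v} \<subseteq> induced_aut X ` S"
    proof
      \<comment> \<open>Openness rests on surjectivity: \<phi> has to come from a homeomorphism,
        which the cuts in \<open>F\<close> then place in \<open>T\<close>.\<close>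
      fix \<phi> assume \<phi>: "\<phi> \<in> {\<phi> \<in> cut_complex_aut X. \<forall>v\<in>F. \<phi> v = g v}"
      then obtain f where f: "f \<in> homeo_group X" "\<phi> = induced_aut X f" using aut_is_induced by blast
      then have "f \<in> T" using F(3) \<phi> f0(1) by simp
      with f show "\<phi> \<in> induced_aut X ` S" using T(2) by blast
    qed
    with F show "\<exists>F. finite F \<and> F \<subseteq> cut_vertices X \<and>
        {\<phi> \<in> cut_complex_aut X. \<forall>v\<in>F. \<phi> v = g v} \<subseteq> induced_aut X ` S" by blast
  qed
qed

lemma homeomorphic_map_induced_aut:
  "homeomorphic_map (compact_open_homeo X) (perm_topology X) (induced_aut X)"
proof (rule bijective_open_imp_homeomorphic_map[OF continuous_map_induced_aut open_map_induced_aut])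
  show "induced_aut X ` topspace (compact_open_homeo X) = topspace (perm_topology X)"
    unfolding topspace_compact_open_homeo topspace_perm_topology
    using induced_aut_in_aut[of _ X] aut_is_induced by (auto simp: image_iff)
  show "inj_on (induced_aut X) (topspace (compact_open_homeo X))"
    unfolding topspace_compact_open_homeo by (rule inj_on_induced_aut)
qed

end

theorem mainTheorem1:
  fixes X :: "'a topology"
  assumes "Stone_space X"
    and "second_countable X"
    and "\<exists>F. finite F \<and> card F \<ge> 5 \<and> F \<subseteq> topspace X"
  shows "induced_aut X ` homeo_group X \<subseteq> cut_complex_aut X
    \<and> (\<forall>f\<in>homeo_group X. \<forall>g\<in>homeo_group X.
          induced_aut X (f \<circ> g) = induced_aut X f \<circ> induced_aut X g)
    \<and> topspace (perm_topology X) = cut_complex_aut X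
    \<and> homeomorphic_map (compact_open_homeo X) (perm_topology X) (induced_aut X)"
proof -
  interpret large_stone_space X
    using assms(1,3) by unfold_locales
  show ?thesis
    using induced_aut_in_aut induced_aut_comp topspace_perm_topology homeomorphic_map_induced_aut by blast
qed

end
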